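(* Let $\mathcal{X}$ be an ellipse in the Euclidean plane and let $a,b,c,d$ be four distinct tangents to $\mathcal{X}$. Then the following statements are equivalent. (i) $a,b,c,d$ are tangent to a circle $\mathcal{C}$. (ii) The intersections $P=a\wedge b$ and $Q=c\wedge d$ lie on a conic $\mathcal{R}$ confocal to $\mathcal{X}$.
   Context: For two lines $a,b$, the symbol $a\wedge b$ denotes their point of intersection. Two conics are confocal if they have the same foci. Projectively: over the complex projective plane with absolute circle points $\mathsf{I}=(1,i,0)$, $\mathsf{J}=(1,-i,0)$, the foci of a conic (neither degenerate nor a circle) are the four intersections, other than $\mathsf{I},\mathsf{J}$ themselves, of the four tangents from $\mathsf{I}$ and $\mathsf{J}$ to the conic, and two conics share the same foci if these tangents are identical. The conic $\mathcal{R}$ may be an ellipse or a hyperbola.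
   Formalization: The ellipse is assumed not to be a circle (foci undefined there), and two positions where the equivalence is false are excluded: P, Q on a common axis but not symmetric about the centre, and P, Q symmetric about the centre but not on an axis. *)

theory Defs
  imports "HOL-Analysis.Analysis"
begin

text \<open>
  Points and lines of the real or complex projective plane are represented by nonzero
  homogeneous coordinate vectors in \<open>'a ^ 3\<close>, up to proportionality. The Euclidean plane
  embeds by \<open>(x, y) \<mapsto> (x, y, 1)\<close>; points with third coordinate 0 are at infinity, so parallel
  lines also have a point of intersection.
\<close>

definition proj_eq :: "'a::field ^ 3 \<Rightarrow> 'a ^ 3 \<Rightarrow> bool" where
  "proj_eq p q \<longleftrightarrow> (\<exists>k. k \<noteq> 0 \<and> q = k *s p)"

definition incident :: "'a::field ^ 3 \<Rightarrow> 'a ^ 3 \<Rightarrow> bool" where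
  "incident p u \<longleftrightarrow> (\<Sum>i\<in>UNIV. p $ i * u $ i) = 0"

text \<open>
  For distinct lines the cross product of the coordinate vectors is nonzero and represents
  the common point.
\<close>

definition meet :: "real ^ 3 \<Rightarrow> real ^ 3 \<Rightarrow> real ^ 3" where
  "meet a b = cross3 a b"


definition is_conic :: "'a::field ^ 3 ^ 3 \<Rightarrow> bool" where
  "is_conic A \<longleftrightarrow> transpose A = A \<and> det A \<noteq> 0"

definition on_conic :: "'a::field ^ 3 ^ 3 \<Rightarrow> 'a ^ 3 \<Rightarrow> bool" where
  "on_conic A p \<longleftrightarrow> p \<noteq> 0 \<and> incident p (A *v p)"

text \<open>
  The tangent of \<open>A\<close> at its point \<open>p\<close> is the polar \<open>A *v p\<close>. Scalar multiples of a tangent's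
  coordinate vector are covered by rescaling \<open>p\<close>.
\<close>

definition tangent :: "'a::field ^ 3 ^ 3 \<Rightarrow> 'a ^ 3 \<Rightarrow> bool" where
  "tangent A u \<longleftrightarrow> (\<exists>p. on_conic A p \<and> u = A *v p)"

definition affine_points :: "real ^ 3 ^ 3 \<Rightarrow> (real ^ 2) set" where
  "affine_points A = {x. on_conic A (vector [x $ 1, x $ 2, 1])}"

definition is_ellipse :: "real ^ 3 ^ 3 \<Rightarrow> bool" where
  "is_ellipse A \<longleftrightarrow> is_conic A \<and> affine_points A \<noteq> {} \<and> (\<forall>p. on_conic A p \<longrightarrow> p $ 3 \<noteq> 0)"

definition is_circle :: "real ^ 3 ^ 3 \<Rightarrow> bool" where
  "is_circle A \<longleftrightarrow> is_conic A \<and> (\<exists>m r. r > 0 \<and> affine_points A = sphere m r)"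


definition complexify :: "real ^ 3 ^ 3 \<Rightarrow> complex ^ 3 ^ 3" where
  "complexify A = (\<chi> i j. complex_of_real (A $ i $ j))"

definition circ_I :: "complex ^ 3" where
  "circ_I = vector [1, \<i>, 0]"

definition circ_J :: "complex ^ 3" where
  "circ_J = vector [1, - \<i>, 0]"

text \<open>
  The foci, as the set of all representatives: the intersections, other than the absolute
  circle points, of the tangents drawn from these two points. Two tangents through the same
  circle point meet only there, so one tangent through each of them is taken.
\<close>

definition foci :: "real ^ 3 ^ 3 \<Rightarrow> (complex ^ 3) set" where
  "foci A = {F. F \<noteq> 0 \<and> \<not> proj_eq circ_I F \<and> \<not> proj_eq circ_J F \<and>
     (\<exists>u v. tangent (complexify A) u \<and> incident circ_I u \<and>
            tangent (complexify A) v \<and> incident circ_J v \<and>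
            \<not> proj_eq u v \<and> incident F u \<and> incident F v)}"

definition confocal :: "real ^ 3 ^ 3 \<Rightarrow> real ^ 3 ^ 3 \<Rightarrow> bool" where
  "confocal A B \<longleftrightarrow> foci A = foci B"


text \<open>
  The notions below describe the exceptional positions of the vertices \<open>P\<close>, \<open>Q\<close>. Let \<open>X\<close> be
  \<open>x^2/4 + y^2 = 1\<close>. The tangents from \<open>(0, 2)\<close> and \<open>(0, 3)\<close> touch a common circle centred on
  the minor axis, but the only curve of the confocal family through both points is the doubled
  minor axis, a degenerate conic. The points \<open>(2, 2)\<close> and \<open>(-2, -2)\<close> lie on a confocal ellipse,
  but the tangents from them form a parallelogram that is not a rhombus, hence without an
  inscribed circle; the circle degenerates to the line at infinity. If the two points lie on a
  common axis and are also symmetric about the centre, neither degeneration is harmful.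
\<close>

text \<open>
  An axis of a central conic is a diameter perpendicular to its conjugate direction, that is,
  the polar of a point \<open>m\<close> at infinity whose normal vector \<open>(u $ 1, u $ 2)\<close> is parallel to
  \<open>(m $ 1, m $ 2)\<close>. An ellipse other than a circle has exactly two axes.
\<close>

definition axis_of :: "real ^ 3 ^ 3 \<Rightarrow> real ^ 3 \<Rightarrow> bool" where
  "axis_of A u \<longleftrightarrow>
     (\<exists>m. m \<noteq> 0 \<and> m $ 3 = 0 \<and> u = A *v m \<and> u $ 1 * m $ 2 = u $ 2 * m $ 1)"

definition on_common_axis :: "real ^ 3 ^ 3 \<Rightarrow> real ^ 3 \<Rightarrow> real ^ 3 \<Rightarrow> bool" where
  "on_common_axis A p q \<longleftrightarrow> (\<exists>u. axis_of A u \<and> incident p u \<and> incident q u)"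

text \<open>
  \<open>p\<close> and \<open>q\<close> are finite and their midpoint, with coordinates \<open>q $ 3 *s p + p $ 3 *s q\<close>, is the
  centre of \<open>A\<close>, the pole of the line at infinity.
\<close>

definition centrally_symmetric :: "real ^ 3 ^ 3 \<Rightarrow> real ^ 3 \<Rightarrow> real ^ 3 \<Rightarrow> bool" where
  "centrally_symmetric A p q \<longleftrightarrow> p $ 3 \<noteq> 0 \<and> q $ 3 \<noteq> 0 \<and>
     proj_eq (vector [0, 0, 1]) (A *v (q $ 3 *s p + p $ 3 *s q))"

end

theory Submission
  imports Defs
begin

text \<open>
  Work with dual conics. Normalised so that its last entry is 1, the dual of the ellipse is
  \<open>Y = z z\<^sup>T - S\<close> with \<open>z\<close> the centre and \<open>S\<close> supported on the upper left 2 by 2 block. With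
  \<open>E = diag(1, 1, 0)\<close>, the circles are \<open>m m\<^sup>T - \<rho> E\<close> and the confocal conics are \<open>Y + \<mu> E\<close>. The
  dual conics touching \<open>a, b, c, d\<close> form the pencil spanned by \<open>Y\<close> and \<open>P Q\<^sup>T + Q P\<^sup>T\<close>, so a
  circle touching the four lines amounts to an identity
  \<open>Y + \<mu> E = k m m\<^sup>T + b (P Q\<^sup>T + Q P\<^sup>T)\<close>. If the left side is invertible, such an identity exists
  exactly when \<open>P\<close> and \<open>Q\<close> lie on the confocal conic with dual \<open>Y + \<mu> E\<close>. Two degenerations
  remain: if \<open>Y + \<mu> E\<close> is singular, then \<open>P\<close> and \<open>Q\<close> lie on a common axis, and if \<open>m\<close> is at
  infinity, then \<open>P\<close> and \<open>Q\<close> are symmetric about the centre. By hypothesis each case entails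
  the other; then \<open>P, Q\<close> are proportional to \<open>z \<plusminus> v\<close> with \<open>v\<close> an eigenvector of \<open>S\<close>, and a
  confocal conic and a circle centred at \<open>z\<close> are both written down explicitly.
\<close>

subsection \<open>Conics and their duals\<close>

definition outer :: "real ^ 3 \<Rightarrow> real ^ 3 \<Rightarrow> real ^ 3 ^ 3" where
  "outer x y = (\<chi> i j. x $ i * y $ j)"

text \<open>The entries \<open>p\<close>, \<open>q\<close>, \<open>s\<close> are those of the block
  \<open>S\<close>. When \<open>z $ 3 = 1\<close>, \<open>cdual z \<rho> 0 \<rho>\<close> is the
  dual of the circle with centre \<open>z\<close> and squared radius \<rho>; adding \<mu> E lowers
  both \<open>p\<close> and \<open>s\<close> by \<mu>.\<close>

definition cdual :: "real ^ 3 \<Rightarrow> real \<Rightarrow> real \<Rightarrow> real \<Rightarrow> real ^ 3 ^ 3" where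
  "cdual z p q s = outer z z - vector [vector [p, q, 0], vector [q, s, 0], 0]"

lemma outer_mult_vec: "outer x y *v u = (y \<bullet> u) *\<^sub>R x"
  by (simp add: outer_def matrix_vector_mult_def inner_vec_def vec_eq_iff sum_distrib_left mult_ac)

lemma cdual_mult_vec:
  "cdual z p q s *v u = (z \<bullet> u) *\<^sub>R z - vector [p * u $ 1 + q * u $ 2, q * u $ 1 + s * u $ 2, 0]"
  by (simp add: cdual_def outer_def vec_eq_iff forall_3 matrix_vector_mult_def inner_vec_def sum_3
      algebra_simps)

lemma cdual_quadratic:
  "u \<bullet> (cdual z p q s *v u)
   = (z \<bullet> u)\<^sup>2 - (p * (u $ 1)\<^sup>2 + 2 * q * u $ 1 * u $ 2 + s * (u $ 2)\<^sup>2)"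
  by (simp add: cdual_mult_vec inner_diff_right inner_vec_def sum_3 power2_eq_square algebra_simps)

lemma transpose_cdual: "transpose (cdual z p q s) = cdual z p q s"
  by (simp add: cdual_def outer_def transpose_def vec_eq_iff forall_3 mult_ac)

text \<open>Eliminating with the last entry 1 clears \<open>outer z z\<close> from the upper left
  block, so the Schur complement is - S, a block of even size.\<close>

lemma det_cdual: "z $ 3 = 1 \<Longrightarrow> det (cdual z p q s) = p * s - q\<^sup>2"
  by (simp add: cdual_def outer_def det_3 power2_eq_square algebra_simps)

lemma symmetric_eq_cdual:
  assumes "transpose Y = Y" "Y $ 3 $ 3 \<noteq> 0"
  shows "\<exists>z p q s. z $ 3 = 1 \<and> Y = (Y $ 3 $ 3) *\<^sub>R cdual z p q s"
proof -
  have [simp]: "Y $ 2 $ 1 = Y $ 1 $ 2" "Y $ 3 $ 1 = Y $ 1 $ 3" "Y $ 3 $ 2 = Y $ 2 $ 3"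
    using assms(1) by (simp_all add: transpose_def vec_eq_iff)
  define g where "g = Y $ 3 $ 3"
  have "g \<noteq> 0" using assms by (simp add: g_def)
  let ?z = "vector [Y $ 1 $ 3 / g, Y $ 2 $ 3 / g, 1] :: real ^ 3"
  have "Y = g *\<^sub>R cdual ?z (?z $ 1 * ?z $ 1 - Y $ 1 $ 1 / g) (?z $ 1 * ?z $ 2 - Y $ 1 $ 2 / g)
      (?z $ 2 * ?z $ 2 - Y $ 2 $ 2 / g)"
    using \<open>g \<noteq> 0\<close> by (simp add: cdual_def outer_def vec_eq_iff forall_3 g_def[symmetric])
  moreover have "?z $ 3 = 1" by simp
  ultimately show ?thesis unfolding g_def by blast
qed

section \<open>Incidence, scaled inverses and tangency in dual form\<close>

lemma inner_symmetric_matrix: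
  fixes M :: "real ^ 'n ^ 'n"
  assumes "transpose M = M"
  shows "x \<bullet> (M *v y) = (M *v x) \<bullet> y"
  by (metis assms dot_lmul_matrix transpose_matrix_vector)

lemma incident_real: "incident p u \<longleftrightarrow> p \<bullet> u = 0" for p :: "real ^ 3"
  by (simp add: incident_def inner_vec_def inner_real_def)

lemma incident_scale:
  fixes p :: "'a::field ^ 3"
  assumes "k \<noteq> 0"
  shows "incident (k *s p) u \<longleftrightarrow> incident p u" "incident p (k *s u) \<longleftrightarrow> incident p u"
  using assms by (simp_all add: incident_def mult_ac flip: sum_distrib_left)

lemma incident_commute: "incident p u \<longleftrightarrow> incident u p"
  by (simp add: incident_def mult.commute)

lemma mat_mult_vec: "mat k *v p = k *s (p :: 'a::field ^ 'n)"
  by (simp add: matrix_vector_mult_def mat_def vec_eq_iff mult_delta_left)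

text \<open>Inverses are needed only up to a factor, because normalising the last entry of a dual
  conic to 1 leaves \<open>mat k\<close> instead of the identity.\<close>

lemma scaled_inverse_commute:
  fixes A B :: "'a::field ^ 'n ^ 'n"
  assumes "A ** B = mat k" "k \<noteq> 0"
  shows "B ** A = mat k"
proof -
  have comm: "mat c ** C = C ** mat c" for c and C :: "'a ^ 'n ^ 'n"
    by (simp add: vec_eq_iff matrix_matrix_mult_def mat_def mult_delta_left mult_delta_right mult.commute)
  have mm: "mat c ** mat d = (mat (c * d) :: 'a ^ 'n ^ 'n)" for c d
    by (simp add: vec_eq_iff matrix_matrix_mult_def mat_def mult_delta_left mult_delta_right)
  have "A ** (B ** mat (inverse k)) = mat 1"
    using assms by (simp add: matrix_mul_assoc mm)
  then have "B ** mat (inverse k) ** A = mat 1"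
    by (simp only: matrix_left_right_inverse)
  then have "mat k ** (mat (inverse k) ** (B ** A)) = mat k"
    by (metis comm matrix_mul_assoc matrix_mul_rid)
  then show ?thesis
    using assms(2) by (simp add: matrix_mul_assoc mm)
qed

text \<open>With \<open>u = A *v p\<close>, the vector \<open>B *v u\<close> is a multiple of
  \<open>p\<close>, so incidence of \<open>p\<close> with its polar becomes the dual quadratic form
  at \<open>u\<close>. A general field covers the real conics and their complexifications
  alike.\<close>

lemma tangent_iff_dual:
  fixes A B :: "'a::field ^ 3 ^ 3"
  assumes AB: "A ** B = mat k" and k: "k \<noteq> 0"
  shows "tangent A u \<longleftrightarrow> u \<noteq> 0 \<and> incident u (B *v u)"
proof
  assume "tangent A u"
  then obtain p where p: "p \<noteq> 0" "incident p (A *v p)" and u: "u = A *v p"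
    by (auto simp: tangent_def on_conic_def)
  have "B *v u = k *s p"
    by (simp add: u matrix_vector_mul_assoc scaled_inverse_commute[OF AB k] mat_mult_vec)
  then show "u \<noteq> 0 \<and> incident u (B *v u)"
    using p k by (auto simp: u incident_scale incident_commute)
next
  assume u: "u \<noteq> 0 \<and> incident u (B *v u)"
  define p where "p = inverse k *s (B *v u)"
  have "A *v p = u"
    using k by (simp add: p_def vector_scalar_commute matrix_vector_mul_assoc AB mat_mult_vec)
  moreover from this have "p \<noteq> 0" using u by auto
  moreover have "incident p u" using u k by (simp add: p_def incident_scale incident_commute)
  ultimately show "tangent A u" unfolding tangent_def on_conic_def by metis
qed

subsection \<open>Pencils of dual conics\<close>

unbundle cross3_syntax

section \<open>Cross products and isotropic vectors\<close>

lemma cross_zero_imp_scale: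
  assumes "a \<times> b = 0" "a \<noteq> 0"
  obtains k where "b = k *\<^sub>R a"
proof -
  have "(a \<bullet> a) *\<^sub>R b = (a \<bullet> b) *\<^sub>R a"
    using Lagrange[of a a b] assms(1) by simp
  moreover have "a \<bullet> a \<noteq> 0" using assms(2) by simp
  ultimately have "b = ((a \<bullet> b) / (a \<bullet> a)) *\<^sub>R a"
    by (metis divide_inverse_commute scaleR_left_imp_eq scaleR_scaleR right_inverse scaleR_one
        mult.assoc)
  then show thesis by (rule that)
qed

text \<open>The triple product expansion of \<open>w \<times> (x \<times> y)\<close> has the
  coefficients \<open>w \<bullet> y\<close> and \<open>- (w \<bullet> x)\<close>, both zero.\<close>

lemma orthogonal_both_imp_scale_cross:
  assumes "w \<bullet> x = 0" "w \<bullet> y = 0" "x \<times> y \<noteq> 0"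
  obtains k where "w = k *\<^sub>R (x \<times> y)"
proof -
  have "(x \<times> y) \<times> w = 0"
    using Lagrange[of w x y] assms cross_skew[of w "x \<times> y"] by simp
  then show thesis using assms(3) that by (rule cross_zero_imp_scale)
qed

lemma not_proj_eq_cross:
  assumes "\<not> proj_eq a b" "a \<noteq> 0" "b \<noteq> 0"
  shows "a \<times> b \<noteq> 0"
proof
  assume "a \<times> b = 0"
  then obtain k where "b = k *\<^sub>R a" using assms(2) by (rule cross_zero_imp_scale)
  moreover from this assms(3) have "k \<noteq> 0" by auto
  ultimately show False using assms(1) by (auto simp: proj_eq_def scalar_mult_eq_scaleR)
qed

text \<open>Cramer's rule, kept free of division by the determinant.\<close>

lemma cross_expansion:
  fixes a b c x :: "real ^ 3"
  shows "(a \<bullet> (b \<times> c)) *\<^sub>R x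
    = (x \<bullet> (b \<times> c)) *\<^sub>R a + (x \<bullet> (c \<times> a)) *\<^sub>R b + (x \<bullet> (a \<times> b)) *\<^sub>R c"
  by (simp add: vec_eq_iff forall_3 cross_components inner_vec_def sum_3 algebra_simps)

text \<open>The expansion in the reciprocal basis of \<open>a\<close>, \<open>b\<close>,
  \<open>c\<close>, again without division.\<close>

lemma cross_expansion_dual:
  fixes a b c x :: "real ^ 3"
  shows "(a \<bullet> (b \<times> c)) *\<^sub>R x
    = (x \<bullet> a) *\<^sub>R (b \<times> c) + (x \<bullet> b) *\<^sub>R (c \<times> a) + (x \<bullet> c) *\<^sub>R (a \<times> b)"
  by (simp add: vec_eq_iff forall_3 cross_components inner_vec_def sum_3 algebra_simps)

lemma orthogonal_triple_zero:
  assumes "a \<bullet> (b \<times> c) \<noteq> 0" "x \<bullet> a = 0" "x \<bullet> b = 0" "x \<bullet> c = 0"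
  shows "x = 0"
  using cross_expansion_dual[of a b c x] assms by simp

text \<open>A nondegenerate form in dimension 3 has no totally isotropic plane: \<open>M\<close>
  would map the span of \<open>x\<close> and \<open>y\<close> into the line spanned by
  \<open>x \<times> y\<close> and could not be injective. For a dual conic, two tangents conjugate
  to each other coincide.\<close>

lemma isotropic_pair:
  fixes M :: "real ^ 3 ^ 3"
  assumes sym: "transpose M = M" and inj: "\<And>x. M *v x = 0 \<Longrightarrow> x = 0"
    and xx: "x \<bullet> (M *v x) = 0" and yy: "y \<bullet> (M *v y) = 0" and xy: "x \<bullet> (M *v y) = 0"
  shows "x \<times> y = 0"
proof (rule ccontr)
  assume n: "x \<times> y \<noteq> 0"
  have yx: "(M *v x) \<bullet> y = 0" using xy inner_symmetric_matrix[OF sym, of x y] by simp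
  obtain k where k: "M *v x = k *\<^sub>R (x \<times> y)"
    using orthogonal_both_imp_scale_cross[OF _ yx n] xx by (metis inner_commute)
  obtain l where l: "M *v y = l *\<^sub>R (x \<times> y)"
    using orthogonal_both_imp_scale_cross[OF _ _ n, of "M *v y"] xy yy by (metis inner_commute)
  have "M *v (l *\<^sub>R x - k *\<^sub>R y) = 0"
    by (simp add: matrix_vector_mult_diff_distrib matrix_vector_mult_scaleR k l)
  then have e: "l *\<^sub>R x = k *\<^sub>R y" using inj by fastforce
  have "x \<noteq> 0" using n by auto
  then have "k \<noteq> 0" using inj[of x] k by auto
  then have "y = (l / k) *\<^sub>R x" using e
    by (metis divide_inverse_commute scaleR_scaleR left_inverse scaleR_one)
  then show False using n by (simp add: cross_mult_right)
qed

text \<open>No three distinct tangents are concurrent. Otherwise \<open>c\<close> has coordinates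
  \<open>x\<close>, \<open>y\<close> in the plane of \<open>a\<close> and \<open>b\<close>, where
  the form reduces to \<open>2 * x * y * (a \<bullet> (M *v b))\<close> and vanishes only on
  multiples of \<open>a\<close> or \<open>b\<close>.\<close>

lemma isotropic_triple:
  fixes M :: "real ^ 3 ^ 3"
  assumes sym: "transpose M = M" and inj: "\<And>x. M *v x = 0 \<Longrightarrow> x = 0"
    and iso: "a \<bullet> (M *v a) = 0" "b \<bullet> (M *v b) = 0" "c \<bullet> (M *v c) = 0"
    and ne: "a \<times> b \<noteq> 0" "a \<times> c \<noteq> 0" "b \<times> c \<noteq> 0"
  shows "a \<bullet> (b \<times> c) \<noteq> 0"
proof
  assume 0: "a \<bullet> (b \<times> c) = 0"
  define n x y where "n = a \<times> b" and "x = c \<bullet> (b \<times> n)" and "y = c \<bullet> (n \<times> a)"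
  have cn: "c \<bullet> n = 0" using 0 cross_triple[of a b c] by (simp add: n_def inner_commute)
  have "a \<bullet> (b \<times> n) = n \<bullet> n" by (metis cross_triple n_def inner_commute)
  then have e: "(n \<bullet> n) *\<^sub>R c = x *\<^sub>R a + y *\<^sub>R b"
    using cross_expansion[of a b n c] cn by (simp add: x_def y_def n_def)
  have nn: "n \<bullet> n \<noteq> 0" using ne by (simp add: n_def)
  have ab: "a \<bullet> (M *v b) \<noteq> 0" using isotropic_pair[OF sym inj iso(1,2)] ne by blast
  have ba: "b \<bullet> (M *v a) = a \<bullet> (M *v b)"
    using inner_symmetric_matrix[OF sym, of a b] by (simp add: inner_commute)
  have "((n \<bullet> n) *\<^sub>R c) \<bullet> (M *v ((n \<bullet> n) *\<^sub>R c)) = 0"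
    using iso by (simp add: matrix_vector_mult_scaleR)
  then have "2 * x * y * (a \<bullet> (M *v b)) = 0"
    unfolding e using iso ba
    by (simp add: matrix_vector_right_distrib matrix_vector_mult_scaleR inner_add_left inner_add_right)
  then consider "x = 0" | "y = 0" using ab by auto
  then show False
  proof cases
    case 1
    then have "b \<times> ((n \<bullet> n) *\<^sub>R c) = 0" using e by (simp add: cross_mult_right)
    then show False using nn ne by (simp add: cross_mult_right)
  next
    case 2
    then have "a \<times> ((n \<bullet> n) *\<^sub>R c) = 0" using e by (simp add: cross_mult_right)
    then show False using nn ne by (simp add: cross_mult_right)
  qed
qed

text \<open>By symmetry the image is orthogonal to the kernel, hence spanned by
  \<open>x \<times> y\<close>. Symmetry against \<open>x \<times> y\<close> itself then fixes the
  coefficient as a linear form in \<open>u\<close>.\<close>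

lemma symmetric_rank_one:
  fixes W :: "real ^ 3 ^ 3"
  assumes sym: "transpose W = W" and "W *v x = 0" "W *v y = 0" and n: "x \<times> y \<noteq> 0"
  obtains k where "\<And>u. W *v u = (k * ((x \<times> y) \<bullet> u)) *\<^sub>R (x \<times> y)"
proof -
  have "\<exists>f. W *v u = f *\<^sub>R (x \<times> y)" for u
    using orthogonal_both_imp_scale_cross[OF _ _ n, of "W *v u"] assms(2,3)
      inner_symmetric_matrix[OF sym, of _ u] by (metis inner_commute inner_zero_left)
  then obtain f where f: "\<And>u. W *v u = f u *\<^sub>R (x \<times> y)" by metis
  let ?l = "x \<times> y"
  have "f u * (?l \<bullet> ?l) = f ?l * (?l \<bullet> u)" for u
    using inner_symmetric_matrix[OF sym, of ?l u] f by simp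
  then have "f u = f ?l / (?l \<bullet> ?l) * (?l \<bullet> u)" for u
    using n by (simp add: field_simps)
  then show thesis using that f by metis
qed

text \<open>This is a degenerate dual conic, the point pair \<open>x\<close>, \<open>y\<close>: its
  quadratic form at \<open>u\<close> is \<open>2 * (x \<bullet> u) * (y \<bullet> u)\<close>, so its
  tangents are the lines through \<open>x\<close> or \<open>y\<close>.\<close>

definition sym_outer :: "real ^ 3 \<Rightarrow> real ^ 3 \<Rightarrow> real ^ 3 ^ 3" where
  "sym_outer x y = outer x y + outer y x"

lemma sym_outer_mult_vec: "sym_outer x y *v u = (y \<bullet> u) *\<^sub>R x + (x \<bullet> u) *\<^sub>R y"
  by (simp add: sym_outer_def matrix_vector_mult_add_rdistrib outer_mult_vec)

lemma transpose_sym_outer: "transpose (sym_outer x y) = sym_outer x y"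
  by (simp add: sym_outer_def outer_def transpose_def vec_eq_iff mult.commute)

text \<open>Since no three of the lines are concurrent, \<open>a\<close>, \<open>b\<close>,
  \<open>c\<close> form a basis. A form vanishing on the diagonal there has three free entries, and
  the condition at \<open>d\<close> ties them by one linear relation, which leaves a pencil.\<close>

lemma dual_pencil:
  fixes Y Z :: "real ^ 3 ^ 3"
  assumes symY: "transpose Y = Y" and symZ: "transpose Z = Z"
    and inj: "\<And>x. Y *v x = 0 \<Longrightarrow> x = 0"
    and Y: "\<And>u. u \<in> {a, b, c, d} \<Longrightarrow> u \<bullet> (Y *v u) = 0"
    and Z: "\<And>u. u \<in> {a, b, c, d} \<Longrightarrow> u \<bullet> (Z *v u) = 0"
    and ne: "a \<times> b \<noteq> 0" "a \<times> c \<noteq> 0" "a \<times> d \<noteq> 0" "b \<times> c \<noteq> 0" "b \<times> d \<noteq> 0" "c \<times> d \<noteq> 0"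
  obtains \<alpha> \<beta> where "Z = \<alpha> *\<^sub>R Y + \<beta> *\<^sub>R sym_outer (a \<times> b) (c \<times> d)"
proof -
  let ?P = "a \<times> b" and ?Q = "c \<times> d"
  have abc: "a \<bullet> (b \<times> c) \<noteq> 0" and abd: "a \<bullet> (b \<times> d) \<noteq> 0" and acd: "a \<bullet> (c \<times> d) \<noteq> 0"
    and bcd: "b \<bullet> (c \<times> d) \<noteq> 0"
    using isotropic_triple[OF symY inj] Y ne by auto
  have orth: "?P \<bullet> a = 0" "?P \<bullet> b = 0" "?Q \<bullet> c = 0" "?Q \<bullet> d = 0"
    by (simp_all add: dot_cross_self)
  have Pc: "?P \<bullet> c \<noteq> 0" using abc by (metis cross_triple inner_commute)
  have Qa: "?Q \<bullet> a \<noteq> 0" using acd by (simp add: inner_commute)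
  have Yab: "a \<bullet> (Y *v b) \<noteq> 0" using isotropic_pair[OF symY inj] Y ne by blast
  \<comment> \<open>The point pair form is zero at \<open>(a, b)\<close>, so \<alpha> alone settles
    that entry of \<open>W\<close>. At \<open>(a, c)\<close> it equals the nonzero product in the
    denominator of \<beta>, which settles the second entry.\<close>
  define \<alpha> where "\<alpha> = (a \<bullet> (Z *v b)) / (a \<bullet> (Y *v b))"
  define \<beta> where "\<beta> = (a \<bullet> (Z *v c) - \<alpha> * (a \<bullet> (Y *v c))) / ((?Q \<bullet> a) * (?P \<bullet> c))"
  define W where "W = Z - \<alpha> *\<^sub>R Y - \<beta> *\<^sub>R sym_outer ?P ?Q"
  have symW: "transpose W = W"
    using symY symZ transpose_sym_outer[of ?P ?Q] by (simp add: W_def transpose_def vec_eq_iff)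
  have W: "u \<bullet> (W *v v) = u \<bullet> (Z *v v) - \<alpha> * (u \<bullet> (Y *v v))
      - \<beta> * ((?Q \<bullet> v) * (?P \<bullet> u) + (?P \<bullet> v) * (?Q \<bullet> u))" for u v
    by (simp add: W_def matrix_vector_mult_diff_rdistrib sym_outer_mult_vec inner_diff_right
        inner_add_right inner_commute scaleR_matrix_vector_assoc[symmetric])
  have iso: "u \<bullet> (W *v u) = 0" if "u \<in> {a, b, c, d}" for u
    using that Y[OF that] Z[OF that] orth by (auto simp: W)
  have sw: "u \<bullet> (W *v v) = v \<bullet> (W *v u)" for u v
    using inner_symmetric_matrix[OF symW, of u v] by (simp add: inner_commute)
  have ab: "a \<bullet> (W *v b) = 0" using Yab orth by (simp add: W \<alpha>_def)
  have ac: "a \<bullet> (W *v c) = 0" using Pc Qa orth by (simp add: W \<beta>_def mult.commute)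
  \<comment> \<open>In the basis \<open>a\<close>, \<open>b\<close>, \<open>c\<close> the value of
    \<open>W\<close> at \<open>d\<close> retains only the term with
    \<open>b \<bullet> (W *v c)\<close>. Its factors \<open>?y\<close> and \<open>?z\<close> are
    nonzero because neither \<open>a\<close>, \<open>c\<close>, \<open>d\<close> nor
    \<open>a\<close>, \<open>b\<close>, \<open>d\<close> are concurrent.\<close>
  let ?x = "d \<bullet> (b \<times> c)" and ?y = "d \<bullet> (c \<times> a)" and ?z = "d \<bullet> (a \<times> b)"
  have e: "(a \<bullet> (b \<times> c)) *\<^sub>R d = ?x *\<^sub>R a + ?y *\<^sub>R b + ?z *\<^sub>R c"
    by (rule cross_expansion)
  have "((a \<bullet> (b \<times> c)) *\<^sub>R d) \<bullet> (W *v ((a \<bullet> (b \<times> c)) *\<^sub>R d)) = 0"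
    using iso by (simp add: matrix_vector_mult_scaleR)
  then have "2 * ?y * ?z * (b \<bullet> (W *v c)) = 0"
    unfolding e using iso ab ac sw[of b a] sw[of c a] sw[of c b]
    by (simp add: matrix_vector_right_distrib matrix_vector_mult_scaleR inner_add_left inner_add_right) auto
  moreover have "?y \<noteq> 0" using acd cross_triple[of c a d] cross_triple[of a c d] cross_triple
    by (metis cross_skew inner_commute inner_minus_right neg_equal_0_iff_equal)
  moreover have "?z \<noteq> 0" using abd by (metis cross_triple inner_commute)
  ultimately have bc: "b \<bullet> (W *v c) = 0" by simp
  have "W *v a = 0" "W *v b = 0" "W *v c = 0"
    using orthogonal_triple_zero[OF abc] ab ac bc iso sw by (metis inner_commute insertCI)+
  then have "W *v x = 0" for x
    using orthogonal_triple_zero[OF abc, of "W *v x"] inner_symmetric_matrix[OF symW, of _ x]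
    by (simp add: inner_commute)
  then have "W = 0" by (simp add: matrix_eq)
  then show thesis using that by (simp add: W_def algebra_simps)
qed

subsection \<open>Ellipses and circles\<close>

lemma conic_inverse:
  fixes A :: "real ^ 3 ^ 3"
  assumes "is_conic A"
  obtains N where "A ** N = mat 1" "transpose N = N"
proof -
  obtain N where N: "A ** N = mat 1"
    using assms by (metis is_conic_def invertible_det_nz invertible_right_inverse)
  have "transpose N ** A = mat 1"
    using assms N by (metis is_conic_def matrix_transpose_mul transpose_mat)
  then have "transpose N = N" using N by (metis matrix_mul_assoc matrix_mul_lid matrix_mul_rid)
  with N show thesis by (rule that)
qed

lemma matrix_mult_scaleR:
  fixes A B :: "real ^ 'n ^ 'n"
  shows "A ** (k *\<^sub>R B) = k *\<^sub>R (A ** B)" "(k *\<^sub>R A) ** B = k *\<^sub>R (A ** B)"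
  by (simp_all add: matrix_matrix_mult_def vec_eq_iff sum_distrib_left mult_ac)

lemma scaleR_mat: "k *\<^sub>R mat l = (mat (k * l) :: real ^ 'n ^ 'n)"
  by (simp add: mat_def vec_eq_iff)

lemma scaled_inverse_unique:
  fixes A B C :: "real ^ 'n ^ 'n"
  assumes "A ** B = mat k" "B ** C = mat l"
  shows "l *\<^sub>R A = k *\<^sub>R C"
proof -
  have m: "mat c = c *\<^sub>R (mat 1 :: real ^ 'n ^ 'n)" for c
    by (simp add: scaleR_mat)
  have "A ** mat l = mat k ** C" using assms by (metis matrix_mul_assoc)
  then show ?thesis
    unfolding m[of l] m[of k] by (simp only: matrix_mult_scaleR matrix_mul_lid matrix_mul_rid)
qed

text \<open>Normalisation requires a nonzero last entry of the inverse \<open>N\<close>. The centre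
  \<open>u\<close> is the pole of the line at infinity and has this entry as third coordinate; if it
  were zero, \<open>u\<close> would be a point of the ellipse at infinity.\<close>

lemma ellipse_dual:
  assumes "is_ellipse X"
  obtains z p q s \<kappa> where "z $ 3 = 1" "\<kappa> \<noteq> 0" "X ** cdual z p q s = mat \<kappa>"
proof -
  obtain N where N: "X ** N = mat 1" "transpose N = N"
    using assms by (auto simp: is_ellipse_def elim: conic_inverse)
  define u where "u = N *v axis 3 1"
  have Xu: "X *v u = axis 3 1" by (simp add: u_def matrix_vector_mul_assoc N)
  have u3: "u $ 3 = N $ 3 $ 3"
    by (simp add: u_def matrix_vector_mult_basis column_def)
  have "u \<noteq> 0" using Xu by (metis axis_eq_0_iff matrix_vector_mult_0_right zero_neq_one)
  then have "u $ 3 \<noteq> 0"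
    using assms Xu by (auto simp: is_ellipse_def on_conic_def incident_real inner_axis)
  define g where "g = N $ 3 $ 3"
  have g: "g \<noteq> 0" using \<open>u $ 3 \<noteq> 0\<close> u3 by (simp add: g_def)
  obtain z p q s where z: "z $ 3 = 1" and Ng: "N = g *\<^sub>R cdual z p q s"
    using symmetric_eq_cdual[OF N(2)] g unfolding g_def by blast
  have "g *\<^sub>R (X ** cdual z p q s) = mat 1"
    using N(1) unfolding Ng matrix_mult_scaleR .
  then have "inverse g *\<^sub>R (g *\<^sub>R (X ** cdual z p q s)) = inverse g *\<^sub>R mat 1"
    by (rule arg_cong)
  then have "X ** cdual z p q s = mat (inverse g)"
    using g by (simp add: scaleR_mat)
  with z g show thesis using that[of z "inverse g"] by simp
qed

section \<open>Circles by centre and squared radius\<close>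

definition circle_mat :: "real ^ 3 \<Rightarrow> real \<Rightarrow> real ^ 3 ^ 3" where
  "circle_mat m \<rho> = vector [vector [1, 0, - m $ 1], vector [0, 1, - m $ 2],
     vector [- m $ 1, - m $ 2, (m $ 1)\<^sup>2 + (m $ 2)\<^sup>2 - \<rho>]]"

lemma circle_mat_dual:
  assumes "m $ 3 = 1"
  shows "circle_mat m \<rho> ** cdual m \<rho> 0 \<rho> = mat (- \<rho>)"
  using assms
  by (simp add: circle_mat_def cdual_def outer_def vec_eq_iff forall_3 matrix_matrix_mult_def sum_3
      mat_def power2_eq_square algebra_simps)

lemma on_circle_mat:
  "on_conic (k *\<^sub>R circle_mat m \<rho>) (vector [x, y, 1])
   \<longleftrightarrow> k * ((x - m $ 1)\<^sup>2 + (y - m $ 2)\<^sup>2 - \<rho>) = 0"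
proof -
  have "vector [x, y, 1] \<noteq> (0 :: real ^ 3)" by (simp add: vec_eq_iff forall_3)
  moreover have "vector [x, y, 1] \<bullet> ((k *\<^sub>R circle_mat m \<rho>) *v vector [x, y, 1])
      = k * ((x - m $ 1)\<^sup>2 + (y - m $ 2)\<^sup>2 - \<rho>)"
    by (simp add: circle_mat_def inner_vec_def sum_3 matrix_vector_mult_def power2_eq_square
        algebra_simps)
  ultimately show ?thesis by (simp add: on_conic_def incident_real del: mult_eq_0_iff)
qed

lemma mem_sphere_real2:
  fixes x m :: "real ^ 2"
  assumes "r > 0"
  shows "x \<in> sphere m r \<longleftrightarrow> (x $ 1 - m $ 1)\<^sup>2 + (x $ 2 - m $ 2)\<^sup>2 = r\<^sup>2"
proof -
  have "x \<in> sphere m r \<longleftrightarrow> (norm (x - m))\<^sup>2 = r\<^sup>2"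
    using assms by (simp add: dist_norm norm_minus_commute)
  also have "(norm (x - m))\<^sup>2 = (x $ 1 - m $ 1)\<^sup>2 + (x $ 2 - m $ 2)\<^sup>2"
    by (simp only: power2_norm_eq_inner) (simp add: inner_vec_def sum_2 power2_eq_square)
  finally show ?thesis .
qed

lemma is_circle_circle_mat:
  assumes "k \<noteq> 0" "\<rho> > 0"
  shows "is_circle (k *\<^sub>R circle_mat m \<rho>)"
proof -
  have "is_conic (k *\<^sub>R circle_mat m \<rho>)"
    using assms
    by (simp add: is_conic_def circle_mat_def transpose_def vec_eq_iff forall_3 det_3
        power2_eq_square algebra_simps)
  moreover have "affine_points (k *\<^sub>R circle_mat m \<rho>) = sphere (vector [m $ 1, m $ 2]) (sqrt \<rho>)"
    using assms
    by (auto simp: affine_points_def on_circle_mat mem_sphere_real2 simp del: mem_sphere)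
  ultimately show ?thesis unfolding is_circle_def using assms(2) real_sqrt_gt_zero by blast
qed

lemma is_circle_obtain:
  assumes "is_circle C"
  obtains m \<rho> k where "m $ 3 = 1" "\<rho> > 0" "k \<noteq> 0" "C = k *\<^sub>R circle_mat m \<rho>"
proof -
  obtain m r where C: "is_conic C" "r > 0" "affine_points C = sphere m r"
    using assms by (auto simp: is_circle_def)
  have sym: "C $ 2 $ 1 = C $ 1 $ 2" "C $ 3 $ 1 = C $ 1 $ 3" "C $ 3 $ 2 = C $ 2 $ 3"
    using C(1) by (simp_all add: is_conic_def transpose_def vec_eq_iff)
  have on: "C $ 1 $ 1 * x\<^sup>2 + 2 * C $ 1 $ 2 * x * y + C $ 2 $ 2 * y\<^sup>2 + 2 * C $ 1 $ 3 * x
      + 2 * C $ 2 $ 3 * y + C $ 3 $ 3 = 0" (is "?q x y = 0")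
    if "(x - m $ 1)\<^sup>2 + (y - m $ 2)\<^sup>2 = r\<^sup>2" for x y
  proof -
    have "vector [x, y] \<in> affine_points C" using that C by (simp add: mem_sphere_real2 del: mem_sphere)
    then have "vector [x, y, 1] \<bullet> (C *v vector [x, y, 1]) = 0"
      by (simp add: affine_points_def on_conic_def incident_real)
    then show ?thesis
      by (simp add: inner_vec_def sum_3 matrix_vector_mult_def power2_eq_square sym algebra_simps)
  qed
  define x y where "x = m $ 1" and "y = m $ 2"
  \<comment> \<open>Six points of the circle determine the matrix up to a factor. Differences at
    opposite points give the linear terms, sums compare the two squares, and the rational direction
    (3/5, 4/5) isolates the mixed term.\<close>
  have e: "?q (x + r) y = 0" "?q (x - r) y = 0" "?q x (y + r) = 0" "?q x (y - r) = 0"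
    "?q (x + 3/5 * r) (y + 4/5 * r) = 0" "?q (x + 3/5 * r) (y - 4/5 * r) = 0"
    by (rule on; simp add: x_def y_def power_mult_distrib power2_eq_square)+
  have r: "r \<noteq> 0" using C by simp
  have 13: "C $ 1 $ 1 * x + C $ 1 $ 2 * y + C $ 1 $ 3 = 0"
  proof -
    have "4 * r * (C $ 1 $ 1 * x + C $ 1 $ 2 * y + C $ 1 $ 3) = ?q (x + r) y - ?q (x - r) y"
      by (simp add: power2_eq_square algebra_simps)
    then show ?thesis using e r by simp
  qed
  have 23: "C $ 1 $ 2 * x + C $ 2 $ 2 * y + C $ 2 $ 3 = 0"
  proof -
    have "4 * r * (C $ 1 $ 2 * x + C $ 2 $ 2 * y + C $ 2 $ 3) = ?q x (y + r) - ?q x (y - r)"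
      by (simp add: power2_eq_square algebra_simps)
    then show ?thesis using e r by simp
  qed
  have 22: "C $ 2 $ 2 = C $ 1 $ 1"
  proof -
    have "2 * r\<^sup>2 * (C $ 1 $ 1 - C $ 2 $ 2)
        = ?q (x + r) y + ?q (x - r) y - ?q x (y + r) - ?q x (y - r)"
      by (simp add: power2_eq_square algebra_simps)
    then show ?thesis using e r by simp
  qed
  have 12: "C $ 1 $ 2 = 0"
  proof -
    have "?q (x + 3/5 * r) (y + 4/5 * r) - ?q (x + 3/5 * r) (y - 4/5 * r)
        = 16/5 * r * (C $ 1 $ 2 * x + C $ 2 $ 2 * y + C $ 2 $ 3) + 48/25 * r\<^sup>2 * C $ 1 $ 2"
      by (simp add: power2_eq_square field_simps)
    then have "48/25 * r\<^sup>2 * C $ 1 $ 2 = 0" unfolding e 23 by simp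
    then show ?thesis using r by simp
  qed
  have 13: "C $ 1 $ 3 = - (C $ 1 $ 1 * x)" and 23: "C $ 2 $ 3 = - (C $ 1 $ 1 * y)"
    using 13 23 12 22 by simp_all
  have 33: "C $ 3 $ 3 = C $ 1 $ 1 * (x\<^sup>2 + y\<^sup>2 - r\<^sup>2)"
    using e(1) unfolding 12 13 22 23 by (simp add: power2_eq_square algebra_simps)
  have "C = (C $ 1 $ 1) *\<^sub>R circle_mat (vector [x, y, 1]) (r\<^sup>2)"
    by (simp add: circle_mat_def vec_eq_iff forall_3 sym 12 13 22 23 33)
  moreover from this have "C $ 1 $ 1 \<noteq> 0"
    using C(1) by (auto simp: is_conic_def det_3)
  moreover have "r\<^sup>2 > 0" using r by simp
  ultimately show thesis using that[of "vector [x, y, 1]" "r\<^sup>2"] by simp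
qed

lemma tangent_iff_cdual:
  assumes "A ** cdual z p q s = mat k" "k \<noteq> 0"
  shows "tangent A u \<longleftrightarrow> u \<noteq> 0 \<and>
    (z \<bullet> u)\<^sup>2 = p * (u $ 1)\<^sup>2 + 2 * q * u $ 1 * u $ 2 + s * (u $ 2)\<^sup>2"
  by (simp add: tangent_iff_dual[OF assms] incident_real cdual_quadratic)

text \<open>The equation says that the line \<open>u\<close> has distance \<open>sqrt \<rho>\<close>
  from the centre \<open>m\<close>.\<close>

lemma tangent_circle_mat:
  assumes "m $ 3 = 1" "k \<noteq> 0" "\<rho> > 0"
  shows "tangent (k *\<^sub>R circle_mat m \<rho>) u \<longleftrightarrow> u \<noteq> 0 \<and> (m \<bullet> u)\<^sup>2 = \<rho> * ((u $ 1)\<^sup>2 + (u $ 2)\<^sup>2)"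
proof -
  have "(k *\<^sub>R circle_mat m \<rho>) ** cdual m \<rho> 0 \<rho> = mat (- k * \<rho>)"
    using assms by (simp add: matrix_mult_scaleR circle_mat_dual scaleR_mat)
  from tangent_iff_cdual[OF this] show ?thesis
    using assms by (simp add: distrib_left)
qed

lemma ex_circle_iff:
  "(\<exists>C. is_circle C \<and> (\<forall>u\<in>U. tangent C u)) \<longleftrightarrow>
   (\<exists>m \<rho>. m $ 3 = 1 \<and> \<rho> > 0 \<and> (\<forall>u\<in>U. u \<noteq> 0 \<and> (m \<bullet> u)\<^sup>2 = \<rho> * ((u $ 1)\<^sup>2 + (u $ 2)\<^sup>2)))"
  (is "?L \<longleftrightarrow> ?R")
proof
  assume ?L
  then obtain C where C: "is_circle C" "\<forall>u\<in>U. tangent C u" by blast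
  from C(1) obtain m \<rho> k where m: "m $ 3 = 1" "\<rho> > 0" "k \<noteq> 0" "C = k *\<^sub>R circle_mat m \<rho>"
    by (rule is_circle_obtain)
  have "\<forall>u\<in>U. u \<noteq> 0 \<and> (m \<bullet> u)\<^sup>2 = \<rho> * ((u $ 1)\<^sup>2 + (u $ 2)\<^sup>2)"
    using C(2) unfolding m(4) tangent_circle_mat[OF m(1,3,2)] .
  with m(1,2) show ?R by blast
next
  assume ?R
  then obtain m \<rho> where "m $ 3 = 1" "\<rho> > 0"
    "\<forall>u\<in>U. u \<noteq> 0 \<and> (m \<bullet> u)\<^sup>2 = \<rho> * ((u $ 1)\<^sup>2 + (u $ 2)\<^sup>2)" by blast
  then have "is_circle (1 *\<^sub>R circle_mat m \<rho>) \<and> (\<forall>u\<in>U. tangent (1 *\<^sub>R circle_mat m \<rho>) u)"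
    using is_circle_circle_mat[of 1] tangent_circle_mat[of m 1] by simp
  then show ?L by blast
qed

text \<open>At the line at infinity the dual form is \<open>(u $ 3)\<^sup>2\<close>, so this line is
  never a tangent. The positive sum serves later to read off the sign of a squared radius.\<close>

lemma tangent_finite:
  fixes z u :: "real ^ 3"
  assumes "z $ 3 = 1" "u \<noteq> 0"
    "(z \<bullet> u)\<^sup>2 = p * (u $ 1)\<^sup>2 + 2 * q * u $ 1 * u $ 2 + s * (u $ 2)\<^sup>2"
  shows "(u $ 1)\<^sup>2 + (u $ 2)\<^sup>2 > 0"
proof (rule ccontr)
  assume "\<not> ?thesis"
  then have u: "u $ 1 = 0" "u $ 2 = 0" by (simp_all add: sum_power2_gt_zero_iff)
  then have "z \<bullet> u = u $ 3" using assms(1) by (simp add: inner_vec_def sum_3)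
  then have "u $ 3 = 0" using assms(3) u by simp
  then have "u = 0" using u by (simp add: vec_eq_iff forall_3)
  then show False using assms(2) by simp
qed

lemma cdual_invertible:
  assumes "A ** cdual z p q s = mat k" "k \<noteq> 0" "z $ 3 = 1"
  shows "p * s - q\<^sup>2 \<noteq> 0"
proof -
  have "det (A ** cdual z p q s) \<noteq> 0"
    unfolding assms(1) using assms(2) by (simp add: det_3 mat_def)
  then show ?thesis using det_cdual[OF assms(3)] by (simp add: det_mul)
qed

text \<open>If \<open>S\<close> were \<open>p\<close> times the identity, \<open>X\<close> would be
  a multiple of \<open>circle_mat z p\<close>. The real tangent \<open>u\<close> ensures
  \<open>p > 0\<close>, hence a genuine circle.\<close>

lemma not_circle_cdual:
  assumes X: "X ** cdual z p q s = mat \<kappa>" "\<kappa> \<noteq> 0" "z $ 3 = 1" and "\<not> is_circle X" and u: "tangent X u"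
  shows "p \<noteq> s \<or> q \<noteq> 0"
proof (rule ccontr)
  assume "\<not> ?thesis"
  then have sq: "s = p" "q = 0" by auto
  have t: "u \<noteq> 0" "(z \<bullet> u)\<^sup>2 = p * (u $ 1)\<^sup>2 + 2 * q * u $ 1 * u $ 2 + s * (u $ 2)\<^sup>2"
    using u by (simp_all add: tangent_iff_cdual[OF X(1,2)])
  have "(z \<bullet> u)\<^sup>2 = p * ((u $ 1)\<^sup>2 + (u $ 2)\<^sup>2)" using t sq by (simp add: algebra_simps)
  then have "p \<ge> 0" using tangent_finite[OF X(3) t]
      zero_le_power2[of "z \<bullet> u"] by (simp add: zero_le_mult_iff)
  moreover have "p \<noteq> 0" using cdual_invertible[OF X] sq by auto
  ultimately have p: "p > 0" by simp
  have "cdual z p q s ** circle_mat z p = mat (- p)"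
    using p scaled_inverse_commute[OF circle_mat_dual[OF X(3)]] unfolding sq by simp
  from scaled_inverse_unique[OF X(1) this]
  have "inverse (-p) *\<^sub>R ((-p) *\<^sub>R X) = inverse (-p) *\<^sub>R (\<kappa> *\<^sub>R circle_mat z p)"
    by (rule arg_cong)
  moreover have "inverse (-p) * -p = 1" using p by simp
  ultimately have "X = (inverse (-p) * \<kappa>) *\<^sub>R circle_mat z p"
    by (simp only: scaleR_scaleR scaleR_one)
  moreover have "is_circle ((inverse (-p) * \<kappa>) *\<^sub>R circle_mat z p)"
    using p X by (intro is_circle_circle_mat) auto
  ultimately show False using assms(4) by argo
qed

subsection \<open>Confocal conics\<close>

lemma complexify_mult: "complexify (A ** B) = complexify A ** complexify B"
  by (simp add: complexify_def matrix_matrix_mult_def vec_eq_iff)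

lemma complexify_mat: "complexify (mat k) = mat (complex_of_real k)"
  by (simp add: complexify_def mat_def vec_eq_iff)

lemma tangent_complexify:
  assumes "A ** B = mat k" "k \<noteq> 0"
  shows "tangent (complexify A) u \<longleftrightarrow> u \<noteq> 0 \<and> incident u (complexify B *v u)"
  using assms by (intro tangent_iff_dual[where k = "complex_of_real k"])
    (simp_all flip: complexify_mult complexify_mat)

lemma incident_complexify_symmetric:
  assumes "transpose B = B"
  shows "incident u (complexify B *v u) \<longleftrightarrow>
    B $ 1 $ 1 * (u $ 1)\<^sup>2 + B $ 2 $ 2 * (u $ 2)\<^sup>2 + B $ 3 $ 3 * (u $ 3)\<^sup>2
    + 2 * B $ 1 $ 2 * u $ 1 * u $ 2 + 2 * B $ 1 $ 3 * u $ 1 * u $ 3 + 2 * B $ 2 $ 3 * u $ 2 * u $ 3 = 0"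
proof -
  have [simp]: "B $ 2 $ 1 = B $ 1 $ 2" "B $ 3 $ 1 = B $ 1 $ 3" "B $ 3 $ 2 = B $ 2 $ 3"
    using assms by (simp_all add: transpose_def vec_eq_iff)
  show ?thesis
    by (simp add: incident_def complexify_def matrix_vector_mult_def sum_3 power2_eq_square
        algebra_simps)
qed

lemma incident_complexify_cdual:
  "incident u (complexify (cdual z p q s) *v u) \<longleftrightarrow>
    (z $ 1 * u $ 1 + z $ 2 * u $ 2 + z $ 3 * u $ 3)\<^sup>2
    = p * (u $ 1)\<^sup>2 + 2 * q * u $ 1 * u $ 2 + s * (u $ 2)\<^sup>2"
  by (subst incident_complexify_symmetric[OF transpose_cdual], subst eq_iff_diff_eq_0)
    (simp add: cdual_def outer_def power2_eq_square algebra_simps)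

lemma incident_circular:
  "incident circ_I u \<longleftrightarrow> u $ 2 = \<i> * u $ 1" "incident circ_J u \<longleftrightarrow> u $ 2 = - \<i> * u $ 1"
proof -
  have "u $ 1 + \<i> * u $ 2 = \<i> * (u $ 2 - \<i> * u $ 1)" "u $ 1 - \<i> * u $ 2 = - \<i> * (u $ 2 + \<i> * u $ 1)"
    by (simp_all add: algebra_simps flip: mult.assoc)
  then show "incident circ_I u \<longleftrightarrow> u $ 2 = \<i> * u $ 1" "incident circ_J u \<longleftrightarrow> u $ 2 = - \<i> * u $ 1"
    by (simp_all add: incident_def circ_I_def circ_J_def sum_3 add_eq_0_iff2 
        del: mult_minus_left)
qed

text \<open>A line through a circle point satisfies
  \<open>(u $ 1)\<^sup>2 + (u $ 2)\<^sup>2 = 0\<close>, so the shift by \<mu> E does not change the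
  dual form there, and only such lines enter the definition of the foci.\<close>

lemma confocal_if_shifted:
  assumes X: "X ** cdual z p q s = mat \<kappa>" "\<kappa> \<noteq> 0"
    and R: "R ** cdual z (p - \<mu>) q (s - \<mu>) = mat k" "k \<noteq> 0"
  shows "confocal R X"
proof -
  have t: "tangent (complexify R) u = tangent (complexify X) u"
    if "u $ 2 = \<i> * u $ 1 \<or> u $ 2 = - \<i> * u $ 1" for u
  proof -
    have "(u $ 2)\<^sup>2 = - (u $ 1)\<^sup>2" using that by (auto simp: power_mult_distrib)
    then show ?thesis
      by (simp add: tangent_complexify[OF X] tangent_complexify[OF R] incident_complexify_cdual
          algebra_simps)
  qed
  show ?thesis unfolding confocal_def foci_def incident_circular
    using t by (intro Collect_cong) metis
qed

text \<open>
  The tangents from the circle point \<open>I\<close> are \<open>(1, \<i>, t)\<close> with \<open>t = - \<zeta> \<plusminus> \<delta>\<close>, where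
  \<open>\<zeta> = z\<^sub>1 + \<i> z\<^sub>2\<close> and \<open>\<delta>\<^sup>2 = p - s + 2 \<i> q\<close> is nonzero unless the conic is a circle. Each of
  them joins \<open>I\<close> to a focus, hence also touches \<open>R\<close>; so the two quadratics in \<open>t\<close> are proportional,
  and comparing their coefficients determines the dual of \<open>R\<close> up to a multiple of \<open>E\<close>.
\<close>

lemma shifted_if_foci_subset:
  assumes X: "X ** cdual z p q s = mat \<kappa>" "\<kappa> \<noteq> 0" "z $ 3 = 1" and nc: "p \<noteq> s \<or> q \<noteq> 0"
    and R: "R ** N = mat 1" "transpose N = N" and sub: "foci X \<subseteq> foci R"
  obtains k \<mu> where "k \<noteq> 0" "N = k *\<^sub>R cdual z (p - \<mu>) q (s - \<mu>)"
proof -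
  define \<zeta> where "\<zeta> = Complex (z $ 1) (z $ 2)"
  define \<delta> where "\<delta> = csqrt (Complex (p - s) (2 * q))"
  have \<zeta>: "\<zeta> = z $ 1 + \<i> * z $ 2" by (simp add: \<zeta>_def complex_eq_iff)
  have \<delta>2: "\<delta>\<^sup>2 = Complex (p - s) (2 * q)" by (simp add: \<delta>_def)
  have \<delta>: "\<delta> \<noteq> 0" using nc \<delta>2 by (auto simp: complex_eq_iff)
  define \<alpha> \<beta> where "\<alpha> = Complex (N $ 1 $ 1 - N $ 2 $ 2) (2 * N $ 1 $ 2)"
    and "\<beta> = Complex (N $ 1 $ 3) (N $ 2 $ 3)"
  have root: "\<alpha> + 2 * t * \<beta> + N $ 3 $ 3 * t\<^sup>2 = 0" if t: "(\<zeta> + t)\<^sup>2 = \<delta>\<^sup>2" for t :: complex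
  proof -
    define u v where "u = (vector [1, \<i>, t] :: complex ^ 3)"
      and "v = (vector [1, - \<i>, cnj t] :: complex ^ 3)"
    \<comment> \<open>\<open>F\<close> is the cross product of \<open>u\<close> with its complex
      conjugate \<open>v\<close>, thus up to a factor a real focus. Its third coordinate is nonzero,
      which separates it from both circle points.\<close>
    define F where "F = (vector [\<i> * (t + cnj t), t - cnj t, - 2 * \<i>] :: complex ^ 3)"
    have "(cnj \<zeta> + cnj t)\<^sup>2 = cnj (\<delta>\<^sup>2)" using t by (metis complex_cnj_add complex_cnj_power)
    then have t': "(z $ 1 - \<i> * z $ 2 + cnj t)\<^sup>2 = p - s - 2 * \<i> * q"
      unfolding \<delta>2 \<zeta> by (simp add: complex_eq_iff)
    have t2: "(z $ 1 + \<i> * z $ 2 + t)\<^sup>2 = p - s + 2 * \<i> * q"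
      using t unfolding \<delta>2 \<zeta> by (simp add: complex_eq_iff)
    have "tangent (complexify X) u" "tangent (complexify X) v"
      using t2 t' X(3) by (simp_all add: tangent_complexify[OF X(1,2)] incident_complexify_cdual
          u_def v_def vec_eq_iff forall_3 mult_ac)
    moreover have "\<not> proj_eq u v" by (auto simp: proj_eq_def u_def v_def vec_eq_iff forall_3)
    moreover have "F \<noteq> 0 \<and> \<not> proj_eq circ_I F \<and> \<not> proj_eq circ_J F"
      by (auto simp: proj_eq_def F_def vec_eq_iff forall_3 circ_I_def circ_J_def)
    moreover have "incident F u" "incident F v"
      by (simp_all add: incident_def F_def u_def v_def sum_3 algebra_simps)
    moreover have "u $ 2 = \<i> * u $ 1" "v $ 2 = - \<i> * v $ 1" by (simp_all add: u_def v_def)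
    ultimately have "F \<in> foci X"
      unfolding foci_def incident_circular by blast
    then have "F \<in> foci R" using sub by blast
    \<comment> \<open>A line through the circle point \<open>I\<close> and \<open>F\<close> must be
      proportional to \<open>u\<close>, so the tangent \<open>w\<close> of \<open>R\<close>
      transfers the root \<open>t\<close> to the quadratic of \<open>R\<close>.\<close>
    then obtain w where w: "tangent (complexify R) w" "w $ 2 = \<i> * w $ 1" "incident F w"
      unfolding foci_def incident_circular by blast
    have "2 * \<i> * (t * w $ 1 - w $ 3) = 0"
      using w(2,3) by (simp add: incident_def F_def sum_3 algebra_simps)
    then have w3: "w $ 3 = t * w $ 1" by simp
    have "w \<noteq> 0" "incident w (complexify N *v w)"
      using w(1) by (simp_all add: tangent_complexify[OF R(1)])
    then have "w $ 1 \<noteq> 0" using w(2) w3 by (auto simp: vec_eq_iff forall_3)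
    moreover have "(w $ 1)\<^sup>2 * (\<alpha> + 2 * t * \<beta> + N $ 3 $ 3 * t\<^sup>2) = 0"
    proof -
      have ab: "\<alpha> = N $ 1 $ 1 - N $ 2 $ 2 + 2 * \<i> * N $ 1 $ 2" "\<beta> = N $ 1 $ 3 + \<i> * N $ 2 $ 3"
        by (simp_all add: \<alpha>_def \<beta>_def complex_eq_iff)
      show ?thesis
        using \<open>incident w (complexify N *v w)\<close> unfolding incident_complexify_symmetric[OF R(2)]
        by (simp add: ab w3 w(2) power2_eq_square algebra_simps)
    qed
    ultimately show ?thesis by simp
  qed
  have r1: "\<alpha> + 2 * (\<delta> - \<zeta>) * \<beta> + N $ 3 $ 3 * (\<delta> - \<zeta>)\<^sup>2 = 0" by (rule root) simp
  have r2: "\<alpha> + 2 * (- \<delta> - \<zeta>) * \<beta> + N $ 3 $ 3 * (- \<delta> - \<zeta>)\<^sup>2 = 0" by (rule root) simp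
  have "4 * \<delta> * (\<beta> - N $ 3 $ 3 * \<zeta>) = 0"
    using r1 r2 by algebra
  then have b: "\<beta> = N $ 3 $ 3 * \<zeta>" using \<delta> by simp
  have a: "\<alpha> = N $ 3 $ 3 * (\<zeta>\<^sup>2 - \<delta>\<^sup>2)" using r1 unfolding b by algebra
  define k where "k = N $ 3 $ 3"
  have N13: "N $ 1 $ 3 = k * z $ 1" "N $ 2 $ 3 = k * z $ 2"
    using b by (simp_all add: \<beta>_def \<zeta>_def complex_eq_iff k_def)
  have N12: "N $ 1 $ 2 = k * (z $ 1 * z $ 2 - q)"
    and N11: "N $ 1 $ 1 - N $ 2 $ 2 = k * ((z $ 1)\<^sup>2 - (z $ 2)\<^sup>2 - (p - s))"
    using a unfolding \<delta>2 by (simp_all add: \<alpha>_def \<zeta>_def complex_eq_iff power2_eq_square k_def algebra_simps)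
  have sym: "N $ 2 $ 1 = N $ 1 $ 2" "N $ 3 $ 1 = N $ 1 $ 3" "N $ 3 $ 2 = N $ 2 $ 3"
    using R(2) by (simp_all add: transpose_def vec_eq_iff)
  have k: "k \<noteq> 0"
  proof
    assume "k = 0"
    then have "N *v axis 3 1 = 0"
      using N13 sym by (simp add: matrix_vector_mult_basis column_def vec_eq_iff forall_3 k_def)
    then have "axis 3 1 = (0 :: real ^ 3)"
      using R(1) by (metis matrix_vector_mul_assoc matrix_vector_mul_lid matrix_vector_mult_0_right)
    then show False by (simp add: axis_eq_0_iff)
  qed
  \<comment> \<open>Only the difference of the first two diagonal entries of \<open>N\<close> is
    known. The shift \<mu> is chosen to fit the first one, and the second follows.\<close>
  define \<mu> where "\<mu> = N $ 1 $ 1 / k - (z $ 1)\<^sup>2 + p"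
  have 11: "N $ 1 $ 1 = k * ((z $ 1)\<^sup>2 - (p - \<mu>))" using k by (simp add: \<mu>_def field_simps)
  have 22: "N $ 2 $ 2 = k * ((z $ 2)\<^sup>2 - (s - \<mu>))" using N11 unfolding 11 by (simp add: algebra_simps)
  have "N = k *\<^sub>R cdual z (p - \<mu>) q (s - \<mu>)"
    using X(3) by (simp add: vec_eq_iff forall_3 cdual_def outer_def sym 11 22 N12 N13
        power2_eq_square flip: k_def)
  then show thesis using k that by blast
qed

text \<open>The vectors \<open>v\<close> and \<open>w\<close> are the tangents of \<open>R\<close>
  at \<open>P\<close> and \<open>Q\<close>, so that incidence is expressed by the dual matrix alone.
  Equality of foci yields the shift; conversely the inverse of a nonsingular shifted dual is the
  desired conic.\<close>

lemma ex_confocal_conic_iff: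
  assumes X: "X ** cdual z p q s = mat \<kappa>" "\<kappa> \<noteq> 0" "z $ 3 = 1" and nc: "p \<noteq> s \<or> q \<noteq> 0"
    and PQ: "P \<noteq> 0" "Q \<noteq> 0"
  shows "(\<exists>R. is_conic R \<and> confocal R X \<and> on_conic R P \<and> on_conic R Q) \<longleftrightarrow>
    (\<exists>\<mu> v w. (p - \<mu>) * (s - \<mu>) \<noteq> q\<^sup>2 \<and>
      cdual z (p - \<mu>) q (s - \<mu>) *v v = P \<and> P \<bullet> v = 0 \<and>
      cdual z (p - \<mu>) q (s - \<mu>) *v w = Q \<and> Q \<bullet> w = 0)" (is "?L \<longleftrightarrow> ?R")
proof
  assume ?L
  then obtain R where R: "is_conic R" "confocal R X" "on_conic R P" "on_conic R Q" by blast
  from R(1) obtain N where N: "R ** N = mat 1" "transpose N = N" by (rule conic_inverse)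
  have "foci X \<subseteq> foci R" using R(2) by (simp add: confocal_def)
  from shifted_if_foci_subset[OF X nc N this]
  obtain k \<mu> where k: "k \<noteq> 0" "N = k *\<^sub>R cdual z (p - \<mu>) q (s - \<mu>)" .
  have "k *\<^sub>R (R ** cdual z (p - \<mu>) q (s - \<mu>)) = mat 1"
    using N(1) unfolding k(2) matrix_mult_scaleR .
  then have "inverse k *\<^sub>R (k *\<^sub>R (R ** cdual z (p - \<mu>) q (s - \<mu>))) = inverse k *\<^sub>R mat 1"
    by (rule arg_cong)
  then have RM: "R ** cdual z (p - \<mu>) q (s - \<mu>) = mat (inverse k)"
    using k by (simp add: scaleR_mat)
  have MR: "cdual z (p - \<mu>) q (s - \<mu>) ** R = mat (inverse k)"
    using k by (intro scaled_inverse_commute[OF RM]) simp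
  have MV: "cdual z (p - \<mu>) q (s - \<mu>) *v (k *\<^sub>R (R *v p')) = p'" for p'
    using k by (simp add: matrix_vector_mult_scaleR matrix_vector_mul_assoc MR mat_mult_vec
        scalar_mult_eq_scaleR)
  moreover have "(p - \<mu>) * (s - \<mu>) \<noteq> q\<^sup>2"
    using cdual_invertible[OF RM _ X(3)] k by simp
  moreover have "P \<bullet> (k *\<^sub>R (R *v P)) = 0" "Q \<bullet> (k *\<^sub>R (R *v Q)) = 0"
    using R(3,4) by (simp_all add: on_conic_def incident_real)
  ultimately show ?R by blast
next
  assume ?R
  then obtain \<mu> v w where d: "(p - \<mu>) * (s - \<mu>) \<noteq> q\<^sup>2"
    and v: "cdual z (p - \<mu>) q (s - \<mu>) *v v = P" "P \<bullet> v = 0"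
    and w: "cdual z (p - \<mu>) q (s - \<mu>) *v w = Q" "Q \<bullet> w = 0" by blast
  define M where "M = cdual z (p - \<mu>) q (s - \<mu>)"
  have "det M \<noteq> 0" using d by (simp add: M_def det_cdual[OF X(3)])
  then have "is_conic M" by (simp add: is_conic_def M_def transpose_cdual)
  then obtain R where R: "M ** R = mat 1" "transpose R = R" by (rule conic_inverse)
  have RM: "R ** M = mat 1" using R(1) by (simp add: matrix_left_right_inverse)
  have "is_conic R" unfolding is_conic_def using R
    by (metis invertible_def invertible_det_nz RM)
  moreover have "confocal R X"
    using confocal_if_shifted[OF X(1,2) RM[unfolded M_def]] by simp
  moreover have "R *v P = v" "R *v Q = w"
    using v(1) w(1) RM by (auto simp: matrix_vector_mul_assoc simp flip: M_def)
  ultimately show ?L using v(2) w(2) PQ by (auto simp: on_conic_def incident_real)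
qed

subsection \<open>Point pairs, axes and the centre\<close>

lemma det_nz_inj:
  fixes M :: "real ^ 'n ^ 'n"
  assumes "det M \<noteq> 0" "M *v x = 0"
  shows "x = 0"
  using assms by (meson invertible_det_nz invertible_left_inverse matrix_left_invertible_ker)

lemma cdual_inj:
  assumes "z $ 3 = 1" "p * s \<noteq> q\<^sup>2" "cdual z p q s *v x = 0"
  shows "x = 0"
  using assms by (intro det_nz_inj[OF _ assms(3)]) (simp add: det_cdual)

text \<open>Pairing \<open>M *v v\<close> with \<open>m \<times> P\<close> removes the multiples of
  \<open>m\<close> and \<open>P\<close> and leaves \<open>P \<bullet> v\<close> times a triple
  product. That product is nonzero, as otherwise \<open>P \<times> Q\<close> would lie in the
  kernel.\<close>

lemma on_conic_if_point_pair_pencil: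
  assumes M: "M = k *\<^sub>R outer m m + b *\<^sub>R sym_outer P Q"
    and inj: "\<And>x. M *v x = 0 \<Longrightarrow> x = 0" and PQ: "P \<times> Q \<noteq> 0" and b: "b \<noteq> 0" and v: "M *v v = P"
  shows "P \<bullet> v = 0"
proof -
  have Mu: "M *v u = (k * (m \<bullet> u)) *\<^sub>R m + b *\<^sub>R ((Q \<bullet> u) *\<^sub>R P + (P \<bullet> u) *\<^sub>R Q)" for u
    by (simp add: M matrix_vector_mult_add_rdistrib sym_outer_mult_vec outer_mult_vec
        flip: scaleR_matrix_vector_assoc)
  have "m \<bullet> (P \<times> Q) \<noteq> 0"
  proof
    assume "m \<bullet> (P \<times> Q) = 0"
    then have "M *v (P \<times> Q) = 0" by (simp add: Mu dot_cross_self)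
    then show False using inj PQ by blast
  qed
  then have t: "Q \<bullet> (m \<times> P) \<noteq> 0"
    using cross_triple[of m P Q] cross_triple[of P Q m] by (simp add: inner_commute)
  have "(M *v v) \<bullet> (m \<times> P) = b * (P \<bullet> v) * (Q \<bullet> (m \<times> P))"
    by (simp add: Mu inner_add_left dot_cross_self)
  moreover have "(M *v v) \<bullet> (m \<times> P) = 0" by (simp add: v dot_cross_self)
  ultimately show ?thesis using b t by simp
qed

text \<open>With \<open>h = P \<bullet> w\<close>, the matrix
  \<open>h *\<^sub>R M - sym_outer P Q\<close> annihilates \<open>v\<close> and \<open>w\<close>, so
  it has rank one. The resulting \<open>l\<close> is the meet of the tangents at \<open>P\<close>
  and \<open>Q\<close>, the future centre of the circle.\<close>

lemma point_pair_pencil_if_on_conic: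
  assumes sym: "transpose M = M" and inj: "\<And>x. M *v x = 0 \<Longrightarrow> x = 0" and PQ: "P \<times> Q \<noteq> 0"
    and v: "M *v v = P" "P \<bullet> v = 0" and w: "M *v w = Q" "Q \<bullet> w = 0"
  obtains h k l where "h \<noteq> 0" "k \<noteq> 0"
    "\<And>u. h *\<^sub>R (M *v u) = (Q \<bullet> u) *\<^sub>R P + (P \<bullet> u) *\<^sub>R Q + (k * (l \<bullet> u)) *\<^sub>R l"
proof -
  have vw: "v \<times> w \<noteq> 0"
  proof
    assume "v \<times> w = 0"
    moreover have "v \<noteq> 0" using v PQ by auto
    ultimately obtain c where "w = c *\<^sub>R v" by (rule cross_zero_imp_scale)
    then have "Q = c *\<^sub>R P" using v w by (simp add: matrix_vector_mult_scaleR)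
    then show False using PQ by (simp add: cross_mult_right)
  qed
  define h where "h = P \<bullet> w"
  have Qv: "Q \<bullet> v = h"
    using inner_symmetric_matrix[OF sym, of v w] v w by (simp add: h_def inner_commute)
  have h: "h \<noteq> 0"
    using isotropic_pair[OF sym inj, of v w] v w vw Qv by (auto simp: inner_commute)
  define W where "W = h *\<^sub>R M - sym_outer P Q"
  have symW: "transpose W = W"
    using sym transpose_sym_outer[of P Q] by (simp add: W_def transpose_def vec_eq_iff)
  have Wu: "W *v u = h *\<^sub>R (M *v u) - ((Q \<bullet> u) *\<^sub>R P + (P \<bullet> u) *\<^sub>R Q)" for u
    by (simp add: W_def matrix_vector_mult_diff_rdistrib sym_outer_mult_vec
        flip: scaleR_matrix_vector_assoc)
  have "W *v v = 0" "W *v w = 0" using v w Qv by (simp_all add: Wu flip: h_def)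
  then obtain k where k: "\<And>u. W *v u = (k * ((v \<times> w) \<bullet> u)) *\<^sub>R (v \<times> w)"
    using symmetric_rank_one[OF symW _ _ vw] by blast
  have "k \<noteq> 0"
  proof
    assume "k = 0"
    then have "h *\<^sub>R (M *v (P \<times> Q)) = 0"
      using k[of "P \<times> Q"] by (simp add: Wu dot_cross_self)
    then show False using h inj PQ by auto
  qed
  moreover have "h *\<^sub>R (M *v u) = (Q \<bullet> u) *\<^sub>R P + (P \<bullet> u) *\<^sub>R Q + (k * ((v \<times> w) \<bullet> u)) *\<^sub>R (v \<times> w)" for u
    using k[of u] unfolding Wu by (simp add: algebra_simps)
  ultimately show thesis using h that by blast
qed

section \<open>Axes and central symmetry in coordinates\<close>

lemma axis_ofI:
  assumes X: "X ** cdual z p q s = mat \<kappa>" "\<kappa> \<noteq> 0" "z $ 3 = 1"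
    and u: "u \<noteq> 0" "z \<bullet> u = 0" "p * u $ 1 + q * u $ 2 = \<nu> * u $ 1" "q * u $ 1 + s * u $ 2 = \<nu> * u $ 2"
  shows "axis_of X u"
proof -
  define m where "m = inverse \<kappa> *\<^sub>R (cdual z p q s *v u)"
  have "X *v m = u"
    using X by (simp add: m_def matrix_vector_mult_scaleR matrix_vector_mul_assoc mat_mult_vec
        scalar_mult_eq_scaleR)
  moreover from this have "m \<noteq> 0" using u by auto
  moreover have "m $ 3 = 0" "u $ 1 * m $ 2 = u $ 2 * m $ 1"
    using u by (simp_all add: m_def cdual_mult_vec)
  ultimately show ?thesis unfolding axis_of_def by metis
qed

text \<open>Together with the converse above: the axes are the lines through the centre whose normal
  is an eigenvector of \<open>S\<close>. The third coordinate of the pole equation gives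
  \<open>z \<bullet> u = 0\<close>, the other two the eigenvector equation.\<close>

lemma axis_ofE:
  assumes X: "X ** cdual z p q s = mat \<kappa>" "\<kappa> \<noteq> 0" "z $ 3 = 1" and "axis_of X u"
  obtains \<nu> where "u \<noteq> 0" "z \<bullet> u = 0"
    "p * u $ 1 + q * u $ 2 = \<nu> * u $ 1" "q * u $ 1 + s * u $ 2 = \<nu> * u $ 2"
proof -
  obtain m where m: "m \<noteq> 0" "m $ 3 = 0" "u = X *v m" "u $ 1 * m $ 2 = u $ 2 * m $ 1"
    using assms(4) by (auto simp: axis_of_def)
  have "cdual z p q s *v u = \<kappa> *\<^sub>R m"
    by (simp add: m(3) matrix_vector_mul_assoc scaled_inverse_commute[OF X(1,2)] mat_mult_vec
        scalar_mult_eq_scaleR)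
  then have e: "(z \<bullet> u) * z $ i - vector [p * u $ 1 + q * u $ 2, q * u $ 1 + s * u $ 2, 0] $ i = \<kappa> * m $ i"
    for i :: 3 by (auto simp: vec_eq_iff cdual_mult_vec)
  have zu: "z \<bullet> u = 0" using e[of 3] X(3) m by simp
  have e1: "p * u $ 1 + q * u $ 2 = - \<kappa> * m $ 1" and e2: "q * u $ 1 + s * u $ 2 = - \<kappa> * m $ 2"
    using e[of 1] e[of 2] zu by simp_all
  have u: "u \<noteq> 0"
  proof
    assume "u = 0"
    then have "m $ 1 = 0" "m $ 2 = 0" using e1 e2 X by simp_all
    then show False using m by (simp add: vec_eq_iff forall_3)
  qed
  have n: "(u $ 1)\<^sup>2 + (u $ 2)\<^sup>2 \<noteq> 0"
  proof
    assume "(u $ 1)\<^sup>2 + (u $ 2)\<^sup>2 = 0"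
    then have "u $ 1 = 0" "u $ 2 = 0" by (simp_all add: sum_power2_eq_zero_iff)
    moreover from this zu X(3) have "u $ 3 = 0" by (simp add: inner_vec_def sum_3)
    ultimately show False using u by (simp add: vec_eq_iff forall_3)
  qed
  define c where "c = (u $ 1 * m $ 1 + u $ 2 * m $ 2) / ((u $ 1)\<^sup>2 + (u $ 2)\<^sup>2)"
  have "m $ 1 = c * u $ 1" "m $ 2 = c * u $ 2"
    using n m(4) by (simp_all add: c_def field_simps power2_eq_square)
  then show thesis using that[of "- \<kappa> * c"] u zu e1 e2 by simp
qed

text \<open>\<open>X\<close> maps \<open>z\<close> to a multiple of the line at infinity, and
  applying the dual matrix reverses this. Comparing third coordinates fixes the factor.\<close>

lemma centrally_symmetric_iff:
  assumes X: "X ** cdual z p q s = mat \<kappa>" "\<kappa> \<noteq> 0" "z $ 3 = 1"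
  shows "centrally_symmetric X P Q \<longleftrightarrow>
    P $ 3 \<noteq> 0 \<and> Q $ 3 \<noteq> 0 \<and> Q $ 3 *\<^sub>R P + P $ 3 *\<^sub>R Q = (2 * P $ 3 * Q $ 3) *\<^sub>R z"
    (is "?L \<longleftrightarrow> ?R")
proof -
  define e :: "real ^ 3" where "e = vector [0, 0, 1]"
  define g where "g = Q $ 3 *\<^sub>R P + P $ 3 *\<^sub>R Q"
  have Ye: "cdual z p q s *v e = z"
    using X(3) by (simp add: e_def cdual_mult_vec inner_vec_def sum_3 vec_eq_iff forall_3)
  have "X *v (cdual z p q s *v e) = \<kappa> *\<^sub>R e"
    by (simp add: matrix_vector_mul_assoc X(1) mat_mult_vec scalar_mult_eq_scaleR)
  then have Xz: "X *v z = \<kappa> *\<^sub>R e" unfolding Ye .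
  have "g = (2 * P $ 3 * Q $ 3) *\<^sub>R z" if "X *v g = k *\<^sub>R e" for k
  proof -
    have "cdual z p q s *v (X *v g) = \<kappa> *\<^sub>R g"
      by (simp add: matrix_vector_mul_assoc scaled_inverse_commute[OF X(1,2)] mat_mult_vec
          scalar_mult_eq_scaleR)
    then have kg: "\<kappa> *\<^sub>R g = k *\<^sub>R z" by (simp add: that matrix_vector_mult_scaleR Ye)
    from arg_cong[OF this, of "\<lambda>x. x $ 3"] have "k = \<kappa> * (2 * P $ 3 * Q $ 3)"
      using X(3) by (simp add: g_def)
    with kg have "\<kappa> *\<^sub>R g = \<kappa> *\<^sub>R ((2 * P $ 3 * Q $ 3) *\<^sub>R z)" by simp
    then show ?thesis using X(2) by (simp only: scaleR_cancel_left) simp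
  qed
  then have "g = (2 * P $ 3 * Q $ 3) *\<^sub>R z" if "proj_eq e (X *v g)"
    using that unfolding proj_eq_def scalar_mult_eq_scaleR by blast
  moreover have "proj_eq e (X *v g)" if "P $ 3 \<noteq> 0" "Q $ 3 \<noteq> 0" "g = (2 * P $ 3 * Q $ 3) *\<^sub>R z"
    using that X(2) unfolding proj_eq_def
    by (intro exI[of _ "2 * P $ 3 * Q $ 3 * \<kappa>"])
      (simp add: matrix_vector_mult_scaleR Xz scalar_mult_eq_scaleR)
  ultimately show ?thesis
    unfolding centrally_symmetric_def scalar_mult_eq_scaleR g_def[symmetric] e_def[symmetric]
    by blast
qed

text \<open>By the trace, the other eigenvalue is \<open>p + s - \<mu>\<close>, on the direction
  perpendicular to \<open>(x, y)\<close>. The quadratic form is this eigenvalue times the squared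
  length plus the eigenvalue difference times the squared component along \<open>(x, y)\<close>;
  multiplication by \<open>x\<^sup>2 + y\<^sup>2\<close> avoids division.\<close>

lemma spectral_decomposition_2:
  fixes p q s \<mu> x y f g :: real
  assumes e: "p * x + q * y = \<mu> * x" "q * x + s * y = \<mu> * y" and n: "x\<^sup>2 + y\<^sup>2 \<noteq> 0"
  shows "p * s - q\<^sup>2 = \<mu> * (p + s - \<mu>)"
    and "(p * f\<^sup>2 + 2 * q * f * g + s * g\<^sup>2) * (x\<^sup>2 + y\<^sup>2)
      = (p + s - \<mu>) * (f\<^sup>2 + g\<^sup>2) * (x\<^sup>2 + y\<^sup>2) + (2 * \<mu> - p - s) * (x * f + y * g)\<^sup>2"
proof -
  define \<nu> where "\<nu> = p + s - \<mu>"
  have p: "p * (x\<^sup>2 + y\<^sup>2) = \<mu> * x\<^sup>2 + \<nu> * y\<^sup>2" unfolding \<nu>_def using e by algebra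
  have q: "q * (x\<^sup>2 + y\<^sup>2) = (\<mu> - \<nu>) * x * y" unfolding \<nu>_def using e by algebra
  have s: "s * (x\<^sup>2 + y\<^sup>2) = \<mu> * y\<^sup>2 + \<nu> * x\<^sup>2" unfolding \<nu>_def using e by algebra
  have "(p * s - q\<^sup>2 - \<mu> * \<nu>) * (x\<^sup>2 + y\<^sup>2)\<^sup>2 = 0" using p q s by algebra
  then show "p * s - q\<^sup>2 = \<mu> * (p + s - \<mu>)" using n by (auto simp: \<nu>_def)
  have "(p * f\<^sup>2 + 2 * q * f * g + s * g\<^sup>2) * (x\<^sup>2 + y\<^sup>2)
      = \<nu> * (f\<^sup>2 + g\<^sup>2) * (x\<^sup>2 + y\<^sup>2) + (\<mu> - \<nu>) * (x * f + y * g)\<^sup>2"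
    using p q s by algebra
  then show "(p * f\<^sup>2 + 2 * q * f * g + s * g\<^sup>2) * (x\<^sup>2 + y\<^sup>2)
      = (p + s - \<mu>) * (f\<^sup>2 + g\<^sup>2) * (x\<^sup>2 + y\<^sup>2) + (2 * \<mu> - p - s) * (x * f + y * g)\<^sup>2"
    by (simp add: \<nu>_def algebra_simps)
qed

lemma symmetric_vertices_on_axis:
  assumes X: "X ** cdual z p q s = mat \<kappa>" "\<kappa> \<noteq> 0" "z $ 3 = 1"
    and c: "centrally_symmetric X P Q" "on_common_axis X P Q" and PQ: "P \<times> Q \<noteq> 0"
  obtains v \<mu> where "v $ 3 = 0" "(v $ 1)\<^sup>2 + (v $ 2)\<^sup>2 > 0"
    "p * v $ 1 + q * v $ 2 = \<mu> * v $ 1" "q * v $ 1 + s * v $ 2 = \<mu> * v $ 2"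
    "P = P $ 3 *\<^sub>R (z + v)" "Q = Q $ 3 *\<^sub>R (z - v)"
proof -
  have P3: "P $ 3 \<noteq> 0" and Q3: "Q $ 3 \<noteq> 0"
    and cs: "Q $ 3 *\<^sub>R P + P $ 3 *\<^sub>R Q = (2 * P $ 3 * Q $ 3) *\<^sub>R z"
    using c(1) by (simp_all add: centrally_symmetric_iff[OF X])
  obtain u where "axis_of X u" and "P \<bullet> u = 0"
    using c(2) by (auto simp: on_common_axis_def incident_real)
  from X \<open>axis_of X u\<close> obtain \<nu> where u: "u \<noteq> 0" "z \<bullet> u = 0"
    "p * u $ 1 + q * u $ 2 = \<nu> * u $ 1" "q * u $ 1 + s * u $ 2 = \<nu> * u $ 2" by (rule axis_ofE)
  define v where "v = inverse (P $ 3) *\<^sub>R P - z"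
  have v3: "v $ 3 = 0" using P3 X(3) by (simp add: v_def)
  have P: "P = P $ 3 *\<^sub>R (z + v)" using P3 by (simp add: v_def)
  have "Q $ 3 *\<^sub>R P = (P $ 3 * Q $ 3) *\<^sub>R (z + v)"
    using arg_cong[OF P, of "scaleR (Q $ 3)"] by (simp add: mult.commute)
  then have "P $ 3 *\<^sub>R Q = (2 * P $ 3 * Q $ 3) *\<^sub>R z - (P $ 3 * Q $ 3) *\<^sub>R (z + v)"
    using cs by (metis add_diff_cancel_left')
  also have "\<dots> = P $ 3 *\<^sub>R (Q $ 3 *\<^sub>R (z - v))"
    by (simp add: vec_eq_iff algebra_simps)
  finally have "P $ 3 *\<^sub>R Q = P $ 3 *\<^sub>R (Q $ 3 *\<^sub>R (z - v))" .
  then have Q: "Q = Q $ 3 *\<^sub>R (z - v)" using P3 by (metis scaleR_cancel_left)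
  have "v \<noteq> 0"
  proof
    assume "v = 0"
    then have "P \<times> Q = (P $ 3 *\<^sub>R z) \<times> (Q $ 3 *\<^sub>R z)"
      using arg_cong2[OF P Q, of cross3] by simp
    then show False using PQ by (simp add: cross_mult_left cross_mult_right)
  qed
  then have n: "(v $ 1)\<^sup>2 + (v $ 2)\<^sup>2 > 0"
    using v3 by (auto simp: sum_power2_gt_zero_iff vec_eq_iff forall_3)
  have "u \<bullet> v = 0"
    using u(2) \<open>P \<bullet> u = 0\<close> by (simp add: v_def inner_diff_right inner_commute)
  then have uv: "u $ 1 * v $ 1 + u $ 2 * v $ 2 = 0"
    using v3 by (simp add: inner_vec_def sum_3)
  have nu: "(u $ 1)\<^sup>2 + (u $ 2)\<^sup>2 \<noteq> 0"
  proof
    assume "(u $ 1)\<^sup>2 + (u $ 2)\<^sup>2 = 0"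
    then have "u $ 1 = 0" "u $ 2 = 0" by (simp_all add: sum_power2_eq_zero_iff)
    moreover from this u(2) X(3) have "u $ 3 = 0" by (simp add: inner_vec_def sum_3)
    ultimately show False using u(1) by (simp add: vec_eq_iff forall_3)
  qed
  \<comment> \<open>\<open>v\<close> is perpendicular to the normal of the axis, so it is
    \<open>t\<close> times the quarter turn of that normal and belongs to the other eigenvalue of
    \<open>S\<close>.\<close>
  define t where "t = (u $ 1 * v $ 2 - u $ 2 * v $ 1) / ((u $ 1)\<^sup>2 + (u $ 2)\<^sup>2)"
  have t: "v $ 1 = - t * u $ 2" "v $ 2 = t * u $ 1"
  proof -
    have "t * ((u $ 1)\<^sup>2 + (u $ 2)\<^sup>2) = u $ 1 * v $ 2 - u $ 2 * v $ 1" using nu by (simp add: t_def)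
    then have "(v $ 1 + t * u $ 2) * ((u $ 1)\<^sup>2 + (u $ 2)\<^sup>2) = 0"
      "(v $ 2 - t * u $ 1) * ((u $ 1)\<^sup>2 + (u $ 2)\<^sup>2) = 0"
      using uv by algebra+
    then show "v $ 1 = - t * u $ 2" "v $ 2 = t * u $ 1" using nu by (auto simp: add_eq_0_iff2)
  qed
  have "p * v $ 1 + q * v $ 2 = (p + s - \<nu>) * v $ 1" "q * v $ 1 + s * v $ 2 = (p + s - \<nu>) * v $ 2"
    unfolding t using u(3,4) by algebra+
  then show thesis using that v3 n P Q by blast
qed

text \<open>The shift by \<open>\<mu> - n\<close> changes the eigenvalue at \<open>v\<close> to
  \<open>n\<close>, the squared length of \<open>v\<close>, so the shifted conic has semi-axis
  \<open>v\<close>. Its tangent at the endpoint \<open>z + v\<close> is \<open>w0\<close>, the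
  perpendicular to \<open>v\<close> there.\<close>

lemma endpoint_on_confocal:
  assumes z: "z $ 3 = 1" and v: "v $ 3 = 0" and n: "n = (v $ 1)\<^sup>2 + (v $ 2)\<^sup>2" "n > 0"
    and e: "p * v $ 1 + q * v $ 2 = \<mu> * v $ 1" "q * v $ 1 + s * v $ 2 = \<mu> * v $ 2"
  obtains w where "cdual z (p - (\<mu> - n)) q (s - (\<mu> - n)) *v w = c *\<^sub>R (z + v)" "(c *\<^sub>R (z + v)) \<bullet> w = 0"
proof -
  define w0 :: "real ^ 3" where
    "w0 = vector [- v $ 1 / n, - v $ 2 / n, 1 + (v $ 1 * z $ 1 + v $ 2 * z $ 2) / n]"
  have zw: "z \<bullet> w0 = 1"
    using n(2) z by (simp add: w0_def inner_vec_def sum_3 field_simps)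
  have "v \<bullet> w0 = - (((v $ 1)\<^sup>2 + (v $ 2)\<^sup>2) / n)"
    using v by (simp add: w0_def inner_vec_def sum_3 power2_eq_square add_divide_distrib)
  then have vw: "v \<bullet> w0 = - 1" unfolding n(1)[symmetric] using n(2) by simp
  have "(p - (\<mu> - n)) * v $ 1 + q * v $ 2 = n * v $ 1" "q * v $ 1 + (s - (\<mu> - n)) * v $ 2 = n * v $ 2"
    using e by (simp_all add: algebra_simps)
  then have "(p - (\<mu> - n)) * w0 $ 1 + q * w0 $ 2 = - v $ 1" "q * w0 $ 1 + (s - (\<mu> - n)) * w0 $ 2 = - v $ 2"
    using n(2) by (simp_all add: w0_def field_simps)
  then have "cdual z (p - (\<mu> - n)) q (s - (\<mu> - n)) *v w0 = z + v"
    unfolding cdual_mult_vec zw using v by (simp add: vec_eq_iff forall_3)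
  then have "cdual z (p - (\<mu> - n)) q (s - (\<mu> - n)) *v (c *\<^sub>R w0) = c *\<^sub>R (z + v)"
    by (simp add: matrix_vector_mult_scaleR)
  moreover have "(c *\<^sub>R (z + v)) \<bullet> (c *\<^sub>R w0) = 0" using zw vw by (simp add: inner_add_left)
  ultimately show thesis by (rule that)
qed

subsection \<open>The equivalence\<close>

text \<open>Neither pencil coefficient can vanish: \<open>\<alpha> = 0\<close> would make the dual
  of the circle a singular point pair, and \<open>\<beta> = 0\<close> would make \<open>S\<close> a
  multiple of the identity. If the shifted dual is singular, a kernel vector is the line joining
  \<open>P\<close> and \<open>Q\<close>.\<close>

lemma confocal_or_axis_if_circle:
  assumes z: "z $ 3 = 1" and nd: "p * s \<noteq> q\<^sup>2" and nc: "p \<noteq> s \<or> q \<noteq> 0"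
    and T: "\<forall>u\<in>{a, b, c, d}.
      (z \<bullet> u)\<^sup>2 = p * (u $ 1)\<^sup>2 + 2 * q * u $ 1 * u $ 2 + s * (u $ 2)\<^sup>2"
    and ne: "a \<times> b \<noteq> 0" "a \<times> c \<noteq> 0" "a \<times> d \<noteq> 0" "b \<times> c \<noteq> 0" "b \<times> d \<noteq> 0" "c \<times> d \<noteq> 0"
    and m: "m $ 3 = 1" and \<rho>: "\<rho> > 0"
    and C: "\<forall>u\<in>{a, b, c, d}. (m \<bullet> u)\<^sup>2 = \<rho> * ((u $ 1)\<^sup>2 + (u $ 2)\<^sup>2)"
    and P: "P = a \<times> b" and Q: "Q = c \<times> d" and PQ: "P \<times> Q \<noteq> 0"
  obtains (confocal) \<mu> v w where "(p - \<mu>) * (s - \<mu>) \<noteq> q\<^sup>2"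
      "cdual z (p - \<mu>) q (s - \<mu>) *v v = P" "P \<bullet> v = 0"
      "cdual z (p - \<mu>) q (s - \<mu>) *v w = Q" "Q \<bullet> w = 0"
  | (axis) \<mu> u where "u \<noteq> 0" "z \<bullet> u = 0" "P \<bullet> u = 0" "Q \<bullet> u = 0"
      "p * u $ 1 + q * u $ 2 = \<mu> * u $ 1" "q * u $ 1 + s * u $ 2 = \<mu> * u $ 2"
proof -
  define Y where "Y = cdual z p q s"
  define Z where "Z = cdual m \<rho> 0 \<rho>"
  have injY: "x = 0" if "Y *v x = 0" for x
    using cdual_inj[OF z nd] that by (simp add: Y_def)
  have injZ: "x = 0" if "Z *v x = 0" for x
    using cdual_inj[OF m _ that[unfolded Z_def]] \<rho> by simp
  have "transpose Y = Y" "transpose Z = Z" by (simp_all add: Y_def Z_def transpose_cdual)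
  moreover have "u \<bullet> (Y *v u) = 0" "u \<bullet> (Z *v u) = 0" if "u \<in> {a, b, c, d}" for u
    using bspec[OF T that] bspec[OF C that] by (simp_all add: Y_def Z_def cdual_quadratic algebra_simps)
  ultimately obtain \<alpha> \<beta> where Z: "Z = \<alpha> *\<^sub>R Y + \<beta> *\<^sub>R sym_outer P Q"
    using dual_pencil[of Y Z a b c d] injY ne unfolding P Q by blast
  have \<alpha>: "\<alpha> \<noteq> 0"
  proof
    assume "\<alpha> = 0"
    then have "Z *v (P \<times> Q) = 0"
      by (simp add: Z sym_outer_mult_vec dot_cross_self flip: scaleR_matrix_vector_assoc)
    then show False using injZ PQ by blast
  qed
  have \<beta>: "\<beta> \<noteq> 0"
  proof
    assume "\<beta> = 0"
    then have e: "Z $ i $ j = \<alpha> * Y $ i $ j" for i j by (simp add: Z)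
    have [simp]: "\<alpha> = 1" using e[of 3 3] z m by (simp add: Z_def Y_def cdual_def outer_def)
    have [simp]: "m $ 1 = z $ 1" "m $ 2 = z $ 2"
      using e[of 1 3] e[of 2 3] z m by (simp_all add: Z_def Y_def cdual_def outer_def)
    show False using e[of 1 1] e[of 1 2] e[of 2 2] nc by (simp add: Z_def Y_def cdual_def outer_def)
  qed
  \<comment> \<open>With this shift, \<alpha> times the shifted dual gains exactly the term \<rho> E
    that turns the dual of the circle into \<open>outer m m\<close>.\<close>
  define \<mu> where "\<mu> = \<rho> / \<alpha>"
  define M where "M = cdual z (p - \<mu>) q (s - \<mu>)"
  have "\<alpha> *\<^sub>R M = outer m m - \<beta> *\<^sub>R sym_outer P Q"
  proof -
    have "\<alpha> *\<^sub>R M = \<alpha> *\<^sub>R Y + \<rho> *\<^sub>R vector [vector [1, 0, 0], vector [0, 1, 0], 0]"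
      using \<alpha> by (simp add: M_def Y_def cdual_def vec_eq_iff forall_3 \<mu>_def algebra_simps)
    moreover have "Z + \<rho> *\<^sub>R vector [vector [1, 0, 0], vector [0, 1, 0], 0] = outer m m"
      by (simp add: Z_def cdual_def vec_eq_iff forall_3)
    ultimately show ?thesis unfolding Z by (simp add: algebra_simps)
  qed
  then have "inverse \<alpha> *\<^sub>R (\<alpha> *\<^sub>R M) = inverse \<alpha> *\<^sub>R (outer m m - \<beta> *\<^sub>R sym_outer P Q)" by (rule arg_cong)
  then have M: "M = inverse \<alpha> *\<^sub>R outer m m + (- \<beta> / \<alpha>) *\<^sub>R sym_outer P Q"
    using \<alpha> by (simp add: scaleR_diff_right divide_inverse mult.commute)
  have M': "M = inverse \<alpha> *\<^sub>R outer m m + (- \<beta> / \<alpha>) *\<^sub>R sym_outer Q P"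
    unfolding M by (simp add: sym_outer_def add.commute)
  have k: "- \<beta> / \<alpha> \<noteq> 0" using \<alpha> \<beta> by simp
  show thesis
  proof (cases "det M = 0")
    case False
    have inj: "x = 0" if "M *v x = 0" for x using False that by (rule det_nz_inj)
    obtain N where "M ** N = mat 1"
      using False by (metis invertible_det_nz invertible_right_inverse)
    then have v: "M *v (N *v p') = p'" for p' by (simp add: matrix_vector_mul_assoc)
    have QP: "Q \<times> P \<noteq> 0" using PQ cross_skew[of P Q] by simp
    show thesis
    proof (rule confocal)
      show "(p - \<mu>) * (s - \<mu>) \<noteq> q\<^sup>2" using False by (simp add: M_def det_cdual[OF z])
      show "cdual z (p - \<mu>) q (s - \<mu>) *v (N *v P) = P" "cdual z (p - \<mu>) q (s - \<mu>) *v (N *v Q) = Q"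
        using v by (simp_all add: M_def)
      show "P \<bullet> (N *v P) = 0" by (rule on_conic_if_point_pair_pencil[OF M inj PQ k v])
      show "Q \<bullet> (N *v Q) = 0" by (rule on_conic_if_point_pair_pencil[OF M' inj QP k v])
    qed
  next
    case True
    have Mu: "M *v u = (inverse \<alpha> * (m \<bullet> u)) *\<^sub>R m + (- \<beta> / \<alpha>) *\<^sub>R ((Q \<bullet> u) *\<^sub>R P + (P \<bullet> u) *\<^sub>R Q)" for u
      unfolding M
      by (simp only: matrix_vector_mult_add_rdistrib sym_outer_mult_vec outer_mult_vec scaleR_scaleR
        flip: scaleR_matrix_vector_assoc)
    \<comment> \<open>If \<open>m\<close> lies on the line \<open>P \<times> Q\<close>, that line is
      in the kernel. Otherwise \<open>m\<close>, \<open>P\<close>, \<open>Q\<close> are independent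
      and the three coefficients of \<open>M *v u\<close> vanish separately.\<close>
    obtain u where u: "u \<noteq> 0" "M *v u = 0" "P \<bullet> u = 0" "Q \<bullet> u = 0"
    proof (cases "m \<bullet> (P \<times> Q) = 0")
      case True
      then have "M *v (P \<times> Q) = 0" by (simp add: Mu dot_cross_self)
      then show thesis using that[of "P \<times> Q"] PQ by (simp add: dot_cross_self)
    next
      case False
      obtain u where u: "u \<noteq> 0" "M *v u = 0"
        using True by (metis invertible_det_nz invertible_left_inverse matrix_left_invertible_ker)
      have "(P \<times> Q) \<bullet> (M *v u) = inverse \<alpha> * (m \<bullet> u) * (m \<bullet> (P \<times> Q))"
        unfolding Mu inner_add_right inner_scaleR_right dot_cross_self
        by (simp add: dot_cross_self inner_commute)
      then have mu: "m \<bullet> u = 0" using u \<alpha> False by simp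
      then have e: "(Q \<bullet> u) *\<^sub>R P + (P \<bullet> u) *\<^sub>R Q = 0"
        using Mu[of u] u(2) k by simp
      have "P \<times> ((Q \<bullet> u) *\<^sub>R P + (P \<bullet> u) *\<^sub>R Q) = (P \<bullet> u) *\<^sub>R (P \<times> Q)"
        "((Q \<bullet> u) *\<^sub>R P + (P \<bullet> u) *\<^sub>R Q) \<times> Q = (Q \<bullet> u) *\<^sub>R (P \<times> Q)"
        by (simp_all add: cross_add_right cross_add_left cross_mult_right cross_mult_left)
      then have "P \<bullet> u = 0" "Q \<bullet> u = 0" using PQ unfolding e by simp_all
      then show thesis using u that by blast
    qed
    have e: "(M *v u) $ i = 0" for i using u by simp
    have zu: "z \<bullet> u = 0" using e[of 3] z by (simp add: M_def cdual_mult_vec)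
    show thesis
    proof (rule axis)
      show "u \<noteq> 0" "z \<bullet> u = 0" "P \<bullet> u = 0" "Q \<bullet> u = 0" using u zu by simp_all
      show "p * u $ 1 + q * u $ 2 = \<mu> * u $ 1" "q * u $ 1 + s * u $ 2 = \<mu> * u $ 2"
        using e[of 1] e[of 2] zu by (simp_all add: M_def cdual_mult_vec algebra_simps)
    qed
  qed
qed

lemma circle_or_symmetric_if_confocal:
  assumes z: "z $ 3 = 1" and nd: "p * s \<noteq> q\<^sup>2"
    and U: "\<forall>u\<in>U. u \<noteq> 0"
    and T: "\<forall>u\<in>U. (z \<bullet> u)\<^sup>2 = p * (u $ 1)\<^sup>2 + 2 * q * u $ 1 * u $ 2 + s * (u $ 2)\<^sup>2"
    and inc: "\<forall>u\<in>U. P \<bullet> u = 0 \<or> Q \<bullet> u = 0"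
    and ab: "a \<in> U" "b \<in> U" "a \<times> b \<noteq> 0" "P \<bullet> a = 0" "P \<bullet> b = 0" and PQ: "P \<times> Q \<noteq> 0"
    and M: "(p - \<mu>) * (s - \<mu>) \<noteq> q\<^sup>2"
      "cdual z (p - \<mu>) q (s - \<mu>) *v v = P" "P \<bullet> v = 0"
      "cdual z (p - \<mu>) q (s - \<mu>) *v w = Q" "Q \<bullet> w = 0"
  obtains (circle) m \<rho> where "m $ 3 = 1" "\<rho> > 0"
      "\<And>u. u \<in> U \<Longrightarrow> (m \<bullet> u)\<^sup>2 = \<rho> * ((u $ 1)\<^sup>2 + (u $ 2)\<^sup>2)"
  | (symmetric) "P $ 3 \<noteq> 0" "Q $ 3 \<noteq> 0" "Q $ 3 *\<^sub>R P + P $ 3 *\<^sub>R Q = (2 * P $ 3 * Q $ 3) *\<^sub>R z"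
proof -
  let ?M = "cdual z (p - \<mu>) q (s - \<mu>)"
  have inj: "x = 0" if "?M *v x = 0" for x using z M(1) that by (rule cdual_inj)
  \<comment> \<open>If \<open>\<mu> = 0\<close>, then \<open>P\<close> lies on the original conic
    and only one tangent passes through it, while \<open>a\<close> and \<open>b\<close> are
    two.\<close>
  have \<mu>: "\<mu> \<noteq> 0"
  proof
    assume "\<mu> = 0"
    then have Y: "cdual z p q s *v v = P" using M(2) by simp
    have "v \<noteq> 0" using Y PQ by auto
    have "\<exists>k. u = k *\<^sub>R v" if "u \<in> U" "P \<bullet> u = 0" for u
    proof -
      have "u \<bullet> (cdual z p q s *v u) = 0" using bspec[OF T that(1)] by (simp add: cdual_quadratic)
      moreover have "v \<bullet> (cdual z p q s *v v) = 0" using Y M(3) by (simp add: inner_commute)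
      moreover have "v \<bullet> (cdual z p q s *v u) = 0"
        using inner_symmetric_matrix[OF transpose_cdual, of v z p q s u] that(2) unfolding Y by simp
      ultimately have "v \<times> u = 0"
        using isotropic_pair[OF transpose_cdual cdual_inj[OF z nd]] by blast
      then show ?thesis using \<open>v \<noteq> 0\<close> by (metis cross_zero_imp_scale)
    qed
    then obtain k l where "a = k *\<^sub>R v" "b = l *\<^sub>R v" using ab by metis
    then show False using ab(3) by (simp add: cross_mult_left cross_mult_right)
  qed
  obtain h k l where h: "h \<noteq> 0" and k: "k \<noteq> 0" and
    e: "\<And>u. h *\<^sub>R (?M *v u) = (Q \<bullet> u) *\<^sub>R P + (P \<bullet> u) *\<^sub>R Q + (k * (l \<bullet> u)) *\<^sub>R l"
    using point_pair_pencil_if_on_conic[OF transpose_cdual inj PQ M(2-5)] by blast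
  \<comment> \<open>On the lines of \<open>U\<close> both the original dual form and the point pair
    form vanish, so only \<mu> E and the square of \<open>l\<close> remain.\<close>
  have t: "h * \<mu> * ((u $ 1)\<^sup>2 + (u $ 2)\<^sup>2) = k * (l \<bullet> u)\<^sup>2" if "u \<in> U" for u
  proof -
    have "u \<bullet> (h *\<^sub>R (?M *v u)) = 2 * (P \<bullet> u) * (Q \<bullet> u) + k * (l \<bullet> u)\<^sup>2"
      unfolding e by (simp add: inner_add_right inner_commute power2_eq_square)
    moreover have "u \<bullet> (h *\<^sub>R (?M *v u)) = h * (\<mu> * ((u $ 1)\<^sup>2 + (u $ 2)\<^sup>2))"
      using bspec[OF T that] by (simp add: cdual_quadratic algebra_simps)
    ultimately show ?thesis using bspec[OF inc that] by auto
  qed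
  show thesis
  proof (cases "l $ 3 = 0")
    case True
    \<comment> \<open>\<open>f\<close> is the line at infinity, whose pole is \<open>z\<close>. When
      \<open>l\<close> is at infinity, evaluating the pencil at \<open>f\<close> leaves only the
      multiples of \<open>P\<close> and \<open>Q\<close>.\<close>
    define f :: "real ^ 3" where "f = vector [0, 0, 1]"
    have f: "x \<bullet> f = x $ 3" for x by (simp add: f_def inner_vec_def sum_3)
    have "?M *v f = z"
      unfolding cdual_mult_vec f using z by (simp add: f_def vec_eq_iff forall_3)
    then have hz: "h *\<^sub>R z = Q $ 3 *\<^sub>R P + P $ 3 *\<^sub>R Q"
      using e[of f] True by (simp add: f)
    from arg_cong[OF this, of "\<lambda>x. x $ 3"] have "h = 2 * P $ 3 * Q $ 3" using z by simp
    then show thesis using h hz by (intro symmetric) auto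
  next
    case False
    define m where "m = inverse (l $ 3) *\<^sub>R l"
    define \<rho> where "\<rho> = h * \<mu> / (k * (l $ 3)\<^sup>2)"
    have c: "(m \<bullet> u)\<^sup>2 = \<rho> * ((u $ 1)\<^sup>2 + (u $ 2)\<^sup>2)" if "u \<in> U" for u
      using t[OF that] k False by (simp add: m_def \<rho>_def power_mult_distrib field_simps)
    have "\<rho> \<ge> 0"
      using c[OF ab(1)] tangent_finite[OF z bspec[OF U ab(1)] bspec[OF T ab(1)]] zero_le_power2[of "m \<bullet> a"]
      by (simp add: zero_le_mult_iff)
    moreover have "\<rho> \<noteq> 0" using h k \<mu> False by (simp add: \<rho>_def)
    ultimately have "\<rho> > 0" by simp
    moreover have "m $ 3 = 1" using False by (simp add: m_def)
    ultimately show thesis using c circle by blast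
  qed
qed

text \<open>A common vertex would make the tangents \<open>a\<close>, \<open>c\<close>,
  \<open>d\<close> concurrent.\<close>

lemma vertices_distinct:
  assumes z: "z $ 3 = 1" and nd: "p * s \<noteq> q\<^sup>2"
    and T: "\<forall>u\<in>{a, b, c, d}.
      (z \<bullet> u)\<^sup>2 = p * (u $ 1)\<^sup>2 + 2 * q * u $ 1 * u $ 2 + s * (u $ 2)\<^sup>2"
    and ne: "a \<times> b \<noteq> 0" "a \<times> c \<noteq> 0" "a \<times> d \<noteq> 0" "c \<times> d \<noteq> 0"
  shows "(a \<times> b) \<times> (c \<times> d) \<noteq> 0"
proof
  assume "(a \<times> b) \<times> (c \<times> d) = 0"
  then obtain k where k: "c \<times> d = k *\<^sub>R (a \<times> b)" using ne(1) by (rule cross_zero_imp_scale)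
  have "u \<bullet> (cdual z p q s *v u) = 0" if "u \<in> {a, b, c, d}" for u
    using bspec[OF T that] by (simp add: cdual_quadratic)
  then have "a \<bullet> (c \<times> d) \<noteq> 0"
    using isotropic_triple[OF transpose_cdual cdual_inj[OF z nd], where a = a and b = c and c = d] ne
    by simp
  then show False unfolding k by (simp add: dot_cross_self)
qed

theorem theorem1:
  fixes X :: "real ^ 3 ^ 3" and a b c d P Q :: "real ^ 3"
  assumes "is_ellipse X" and "\<not> is_circle X"
    and "tangent X a" and "tangent X b" and "tangent X c" and "tangent X d"
    and "\<not> proj_eq a b" and "\<not> proj_eq a c" and "\<not> proj_eq a d"
    and "\<not> proj_eq b c" and "\<not> proj_eq b d" and "\<not> proj_eq c d"
    and "P = meet a b" and "Q = meet c d"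
    and "on_common_axis X P Q \<Longrightarrow> centrally_symmetric X P Q"
    and "centrally_symmetric X P Q \<Longrightarrow> on_common_axis X P Q"
  shows "(\<exists>C. is_circle C \<and> tangent C a \<and> tangent C b \<and> tangent C c \<and> tangent C d) \<longleftrightarrow>
         (\<exists>R. is_conic R \<and> confocal R X \<and> on_conic R P \<and> on_conic R Q)"
    (is "?circle \<longleftrightarrow> ?confocal")
proof -
  from assms(1) obtain z p q s \<kappa> where X: "X ** cdual z p q s = mat \<kappa>" "\<kappa> \<noteq> 0" "z $ 3 = 1"
    by (rule ellipse_dual) blast
  note z = X(3)
  have nd: "p * s \<noteq> q\<^sup>2" using cdual_invertible[OF X] by simp
  have nc: "p \<noteq> s \<or> q \<noteq> 0" using X assms(2,3) by (rule not_circle_cdual)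
  define U where "U = {a, b, c, d}"
  have "tangent X u" if "u \<in> U" for u using that assms(3-6) by (auto simp: U_def)
  then have U: "u \<noteq> 0"
    and T: "(z \<bullet> u)\<^sup>2 = p * (u $ 1)\<^sup>2 + 2 * q * u $ 1 * u $ 2 + s * (u $ 2)\<^sup>2" if "u \<in> U" for u
    using that by (simp_all add: tangent_iff_cdual[OF X(1,2)])
  have TU: "\<forall>u\<in>U. (z \<bullet> u)\<^sup>2 = p * (u $ 1)\<^sup>2 + 2 * q * u $ 1 * u $ 2 + s * (u $ 2)\<^sup>2"
    and U0: "\<forall>u\<in>U. u \<noteq> 0" using T U by blast+
  have ne: "a \<times> b \<noteq> 0" "a \<times> c \<noteq> 0" "a \<times> d \<noteq> 0" "b \<times> c \<noteq> 0" "b \<times> d \<noteq> 0" "c \<times> d \<noteq> 0"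
    using assms(7-12)[THEN not_proj_eq_cross] U by (simp_all add: U_def)
  have P: "P = a \<times> b" and Q: "Q = c \<times> d" using assms(13,14) by (simp_all add: meet_def)
  have PQ: "P \<times> Q \<noteq> 0"
    unfolding P Q by (rule vertices_distinct[OF z nd TU[unfolded U_def] ne(1-3,6)])
  have P0: "P \<noteq> 0" and Q0: "Q \<noteq> 0" using PQ by auto
  have inc: "\<forall>u\<in>U. P \<bullet> u = 0 \<or> Q \<bullet> u = 0"
    by (auto simp: P Q U_def dot_cross_self)
  have circle_iff: "?circle \<longleftrightarrow> (\<exists>m \<rho>. m $ 3 = 1 \<and> \<rho> > 0 \<and>
      (\<forall>u\<in>U. (m \<bullet> u)\<^sup>2 = \<rho> * ((u $ 1)\<^sup>2 + (u $ 2)\<^sup>2)))"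
    using ex_circle_iff[of U] U by (simp add: U_def)
  have det_eq: "(p - \<mu>) * (s - \<mu>) - q\<^sup>2 = p * s - q\<^sup>2 - \<mu> * (p + s - \<mu>)" for \<mu>
    by (simp add: algebra_simps)
  show ?thesis
  proof
    assume ?circle
    then obtain m \<rho> where m: "m $ 3 = 1" "\<rho> > 0"
      and C: "\<forall>u\<in>U. (m \<bullet> u)\<^sup>2 = \<rho> * ((u $ 1)\<^sup>2 + (u $ 2)\<^sup>2)"
      unfolding circle_iff by blast
    show ?confocal
    proof (cases rule: confocal_or_axis_if_circle[OF z nd nc TU[unfolded U_def] ne m
          C[unfolded U_def] P Q PQ, case_names confocal axis])
      case (confocal \<mu> v w)
      then show ?thesis using ex_confocal_conic_iff[OF X nc P0 Q0] by blast
    next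
      case (axis \<mu> u)
      then have "axis_of X u" by (intro axis_ofI[OF X])
      then have on: "on_common_axis X P Q"
        using axis by (auto simp: on_common_axis_def incident_real)
      \<comment> \<open>Symmetry about the centre is now available, so \<open>P\<close> and
        \<open>Q\<close> are the ends of an axis of the confocal conic with parameter
        \<open>\<nu> - n\<close>.\<close>
      from X assms(15)[OF on] on PQ obtain v \<nu> where v: "v $ 3 = 0" "(v $ 1)\<^sup>2 + (v $ 2)\<^sup>2 > 0"
        and e: "p * v $ 1 + q * v $ 2 = \<nu> * v $ 1" "q * v $ 1 + s * v $ 2 = \<nu> * v $ 2"
        and Pv: "P = P $ 3 *\<^sub>R (z + v)" and Qv: "Q = Q $ 3 *\<^sub>R (z - v)"
        by (rule symmetric_vertices_on_axis)
      define n where "n = (v $ 1)\<^sup>2 + (v $ 2)\<^sup>2"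
      have n: "n > 0" using v by (simp add: n_def)
      note sd = spectral_decomposition_2[OF e v(2)[THEN less_imp_neq, symmetric], folded n_def]
      obtain v' where v': "cdual z (p - (\<nu> - n)) q (s - (\<nu> - n)) *v v' = P $ 3 *\<^sub>R (z + v)"
        "(P $ 3 *\<^sub>R (z + v)) \<bullet> v' = 0"
        using z v(1) n_def n e by (rule endpoint_on_confocal)
      obtain w' where w': "cdual z (p - (\<nu> - n)) q (s - (\<nu> - n)) *v w' = Q $ 3 *\<^sub>R (z + - v)"
        "(Q $ 3 *\<^sub>R (z + - v)) \<bullet> w' = 0"
        by (rule endpoint_on_confocal[OF z, of "- v" n p q \<nu> s]) (use v e n in \<open>simp_all add: n_def\<close>)
      \<comment> \<open>A singular shift would mean that \<open>n\<close> is the difference of the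
        eigenvalues of \<open>S\<close>, so \<open>P\<close> and \<open>Q\<close> would be real
        foci. The tangent \<open>a\<close> through \<open>P\<close> then forces the second
        eigenvalue to vanish.\<close>
      have "(p - (\<nu> - n)) * (s - (\<nu> - n)) \<noteq> q\<^sup>2"
      proof
        assume "(p - (\<nu> - n)) * (s - (\<nu> - n)) = q\<^sup>2"
        then have "n * (p + s - \<nu> - (\<nu> - n)) = 0"
          using det_eq[of "\<nu> - n"] sd(1) by (simp add: algebra_simps)
        then have ps: "2 * \<nu> - p - s = n" using n by simp
        have aU: "a \<in> U" by (simp add: U_def)
        have "(P $ 3 *\<^sub>R (z + v)) \<bullet> a = 0"
          by (subst Pv[symmetric]) (simp add: P dot_cross_self)
        moreover have "P $ 3 \<noteq> 0" using Pv P0 by auto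
        ultimately have "z \<bullet> a = - (v \<bullet> a)" by (simp add: inner_add_left)
        then have "(z \<bullet> a)\<^sup>2 = (v \<bullet> a)\<^sup>2" by simp
        then have "(z \<bullet> a)\<^sup>2 = (v $ 1 * a $ 1 + v $ 2 * a $ 2)\<^sup>2"
          using v(1) by (simp add: inner_vec_def sum_3)
        then have "(p + s - \<nu>) * ((a $ 1)\<^sup>2 + (a $ 2)\<^sup>2) * n = 0"
          using T[OF aU] sd(2)[of "a $ 1" "a $ 2"] unfolding ps by simp
        then have "p + s - \<nu> = 0" using n tangent_finite[OF z U[OF aU] T[OF aU]] by auto
        then show False using sd(1) nd by simp
      qed
      then show ?thesis
        using v' w' unfolding ex_confocal_conic_iff[OF X nc P0 Q0]
        by (metis Pv Qv add_uminus_conv_diff)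
    qed
  next
    assume ?confocal
    then obtain \<mu> v w where M: "(p - \<mu>) * (s - \<mu>) \<noteq> q\<^sup>2"
      "cdual z (p - \<mu>) q (s - \<mu>) *v v = P" "P \<bullet> v = 0"
      "cdual z (p - \<mu>) q (s - \<mu>) *v w = Q" "Q \<bullet> w = 0"
      unfolding ex_confocal_conic_iff[OF X nc P0 Q0] by blast
    have ab: "a \<in> U" "b \<in> U" "P \<bullet> a = 0" "P \<bullet> b = 0"
      by (simp_all add: U_def P dot_cross_self)
    show ?circle
    proof (cases rule: circle_or_symmetric_if_confocal[OF z nd U0 TU inc ab(1,2) ne(1) ab(3,4) PQ M,
          case_names circle symmetric])
      case (circle m \<rho>)
      then show ?thesis unfolding circle_iff by blast
    next
      case symmetric
      then have cs: "centrally_symmetric X P Q" by (simp add: centrally_symmetric_iff[OF X])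
      from X cs assms(16)[OF cs] PQ obtain v \<nu> where v: "v $ 3 = 0" "(v $ 1)\<^sup>2 + (v $ 2)\<^sup>2 > 0"
        and e: "p * v $ 1 + q * v $ 2 = \<nu> * v $ 1" "q * v $ 1 + s * v $ 2 = \<nu> * v $ 2"
        and Pv: "P = P $ 3 *\<^sub>R (z + v)" and Qv: "Q = Q $ 3 *\<^sub>R (z - v)"
        by (rule symmetric_vertices_on_axis)
      define n where "n = (v $ 1)\<^sup>2 + (v $ 2)\<^sup>2"
      have n: "n > 0" using v by (simp add: n_def)
      note sd = spectral_decomposition_2[OF e v(2)[THEN less_imp_neq, symmetric], folded n_def]
      \<comment> \<open>Every line of \<open>U\<close> passes through \<open>z + v\<close> or
        \<open>z - v\<close>, so \<open>z \<bullet> u\<close> and \<open>v \<bullet> u\<close> agree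
        up to sign. Eliminating \<open>v \<bullet> u\<close> by the spectral form makes the distance
        from \<open>z\<close> the same for all four lines, and \<rho> is its square.\<close>
      have zu: "(z \<bullet> u)\<^sup>2 * (n - (2 * \<nu> - p - s)) = (p + s - \<nu>) * n * ((u $ 1)\<^sup>2 + (u $ 2)\<^sup>2)"
        if "u \<in> U" for u
      proof -
        have "(z + v) \<bullet> u = 0 \<or> (z - v) \<bullet> u = 0"
          using bspec[OF inc that] Pv Qv symmetric by (metis inner_scaleR_left mult_eq_0_iff)
        then have "(z \<bullet> u)\<^sup>2 = (v \<bullet> u)\<^sup>2"
          by (auto simp: inner_add_left inner_diff_left add_eq_0_iff2)
        then have "(z \<bullet> u)\<^sup>2 = (v $ 1 * u $ 1 + v $ 2 * u $ 2)\<^sup>2"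
          using v(1) by (simp add: inner_vec_def sum_3)
        then show ?thesis using T[OF that] sd(2)[of "u $ 1" "u $ 2"] by algebra
      qed
      have \<nu>: "p + s - \<nu> \<noteq> 0" using sd(1) nd by auto
      note fin = tangent_finite[OF z U[OF ab(1)] T[OF ab(1)]]
      have c: "n - (2 * \<nu> - p - s) \<noteq> 0" using zu[OF ab(1)] \<nu> n fin by auto
      define \<rho> where "\<rho> = (p + s - \<nu>) * n / (n - (2 * \<nu> - p - s))"
      have \<rho>: "(z \<bullet> u)\<^sup>2 = \<rho> * ((u $ 1)\<^sup>2 + (u $ 2)\<^sup>2)" if "u \<in> U" for u
        using zu[OF that] c by (simp add: \<rho>_def eq_divide_eq)
      have "\<rho> \<ge> 0" using \<rho>[OF ab(1)] fin zero_le_power2[of "z \<bullet> a"] by (simp add: zero_le_mult_iff)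
      moreover have "\<rho> \<noteq> 0" using \<nu> n c by (simp add: \<rho>_def)
      ultimately show ?thesis unfolding circle_iff using z \<rho> by (intro exI[of _ z] exI[of _ \<rho>]) auto
    qed
  qed
qed

end
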